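(* Let $\mathfrak n=\mathfrak v\oplus\mathfrak z$ be a Lie algebra of Heisenberg type with $\mathfrak z=\mathbb R^m$. If $m\not\equiv0\pmod 4$, then ${\rm Aut}_o(\mathfrak n)$ acts transitively on ${\rm Lag}(\mathfrak n)$. If $m\equiv0\pmod4$ and $\mathfrak n=(\mathfrak v_m)^p\oplus\mathfrak z$, then ${\rm Lag}(\mathfrak n)$ is the union of $p+1$ orbits of ${\rm Aut}_o(\mathfrak n)$.
   Context: Lie algebra of Heisenberg type: $\mathfrak z=\mathbb R^m$ with standard inner product; $\mathfrak v$ a finite-dimensional real module over the Clifford algebra $C(m)$ (relations $z^2=-\langle z,z\rangle1$) with an inner product making each $J_z$ skew-symmetric; $\mathfrak z$ central and $\langle z,[u,v]\rangle=(J_zu,v)$. For $m\not\equiv3\pmod4$ there is a unique irreducible $C(m)$-module $\mathfrak v_m$ up to isomorphism, and $(\mathfrak v_m)^p$ denotes the direct sum of $p$ copies. ${\rm Lag}(\mathfrak n)$ is the set of subspaces $\mathcal L\subset\mathfrak v$ with $[\mathcal L,\mathcal L]=0$ and $\dim\mathcal L=\frac12\dim\mathfrak v$. ${\rm Aut}_o(\mathfrak n)$ is the group of Lie algebra automorphisms of $\mathfrak n$ acting trivially on $\mathfrak z$, viewed as the group of linear automorphisms $\xi$ of $\mathfrak v$ with $[\xi u,\xi v]=[u,v]$ for all $u,v\in\mathfrak v$; it acts on ${\rm Lag}(\mathfrak n)$. *)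

theory Defs
  imports "HOL-Analysis.Analysis"
begin

text \<open>A Lie algebra of Heisenberg type n = v + z is encoded by the Clifford module
  structure J : z -> End(v), with z = R^m (a euclidean space of dimension m = DIM('z))
  and v a finite-dimensional real inner product space (euclidean space).\<close>

definition htype :: "('z::euclidean_space \<Rightarrow> 'v::euclidean_space \<Rightarrow> 'v) \<Rightarrow> bool" where
  "htype J \<longleftrightarrow>
     (\<forall>z. linear (J z)) \<and> (\<forall>u. linear (\<lambda>z. J z u)) \<and>
     (\<forall>z u. J z (J z u) = - (z \<bullet> z) *\<^sub>R u) \<and>
     (\<forall>z u w. (J z u) \<bullet> w = - (u \<bullet> (J z w)))"

text \<open>The bracket [u,w] in z, characterised by <z,[u,w]> = (J_z u, w).\<close>
definition hbracket :: "('z::euclidean_space \<Rightarrow> 'v::euclidean_space \<Rightarrow> 'v) \<Rightarrow> 'v \<Rightarrow> 'v \<Rightarrow> 'z" where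
  "hbracket J u w = (\<Sum>b\<in>Basis. ((J b u) \<bullet> w) *\<^sub>R b)"

definition Lag :: "('z::euclidean_space \<Rightarrow> 'v::euclidean_space \<Rightarrow> 'v) \<Rightarrow> 'v set set" where
  "Lag J = {L. subspace L \<and> (\<forall>u\<in>L. \<forall>w\<in>L. hbracket J u w = 0) \<and> 2 * dim L = DIM('v)}"

definition Aut_o :: "('z::euclidean_space \<Rightarrow> 'v::euclidean_space \<Rightarrow> 'v) \<Rightarrow> ('v \<Rightarrow> 'v) set" where
  "Aut_o J = {\<xi>. linear \<xi> \<and> bij \<xi> \<and> (\<forall>u w. hbracket J (\<xi> u) (\<xi> w) = hbracket J u w)}"

definition aut_orbit :: "('z::euclidean_space \<Rightarrow> 'v::euclidean_space \<Rightarrow> 'v) \<Rightarrow> 'v set \<Rightarrow> 'v set set" where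
  "aut_orbit J L = (\<lambda>\<xi>. \<xi> ` L) ` Aut_o J"

definition submodule :: "('z::euclidean_space \<Rightarrow> 'v::real_vector \<Rightarrow> 'v) \<Rightarrow> 'v set \<Rightarrow> bool" where
  "submodule J W \<longleftrightarrow> subspace W \<and> (\<forall>z. \<forall>u\<in>W. J z u \<in> W)"

definition irreducible_submodule :: "('z::euclidean_space \<Rightarrow> 'v::real_vector \<Rightarrow> 'v) \<Rightarrow> 'v set \<Rightarrow> bool" where
  "irreducible_submodule J W \<longleftrightarrow> submodule J W \<and> W \<noteq> {0} \<and>
     (\<forall>U. submodule J U \<and> U \<subseteq> W \<longrightarrow> U = {0} \<or> U = W)"

text \<open>v is isomorphic to (v_m)^p: v is the (internal) direct sum of p irreducible submodules;
  for m not 3 mod 4 all irreducible C(m)-modules are isomorphic to v_m.\<close>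
definition isotypic_power :: "('z::euclidean_space \<Rightarrow> 'v::euclidean_space \<Rightarrow> 'v) \<Rightarrow> nat \<Rightarrow> bool" where
  "isotypic_power J p \<longleftrightarrow> (\<exists>W :: nat \<Rightarrow> 'v set.
     (\<forall>i<p. irreducible_submodule J (W i)) \<and>
     span (\<Union>i<p. W i) = UNIV \<and> (\<Sum>i<p. dim (W i)) = DIM('v))"

end

theory Submission
  imports Defs
begin

text \<open>A Lagrangian \<open>L\<close> satisfies \<open>J\<^sub>z L = L\<^sup>\<bottom>\<close> for \<open>z \<noteq> 0\<close>, so it is a module over the even
  Clifford algebra, which is generated by \<open>m - 1\<close> anticommuting isometries with square \<open>-1\<close>.
  An isometric isomorphism \<open>f\<close> of two Lagrangians as even modules extends to the automorphism
  \<open>u + J\<^sub>e v \<mapsto> f u + J\<^sub>e (f v)\<close>, so orbits correspond to isomorphism classes of even modules.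

  Averaging a rank one map over all products of generators gives an intertwiner. Some such average is
  nonzero, because every nontrivial product has trace zero, with the possible exception of the
  volume element when \<open>m\<close> is divisible by 4. Splitting off the image of such an intertwiner
  repeatedly shows that the dimension determines the module if \<open>m\<close> is not divisible by 4.
  If it is, the volume element is a symmetric involution commuting with the even
  algebra and anticommuting with each \<open>J\<^sub>z\<close>, and the isomorphism class is determined by the dimension of
  its \<open>+1\<close>-eigenspace in \<open>L\<close>. With \<open>d\<close> half the dimension of an irreducible
  module, the values taken by that dimension are exactly \<open>0, d, 2d, \<dots>, pd\<close>.\<close>

section \<open>Euclidean preliminaries\<close>

lemma orthogonal_projection_exists:
  fixes K :: "'a::euclidean_space set"
  assumes "subspace K"
  obtains P where "linear P" "\<And>x. P x \<in> K" "\<And>x y. y \<in> K \<Longrightarrow> (x - P x) \<bullet> y = 0"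
    "\<And>x. x \<in> K \<Longrightarrow> P x = x" "\<And>x. (\<And>y. y \<in> K \<Longrightarrow> x \<bullet> y = 0) \<Longrightarrow> P x = 0"
proof -
  obtain B where B: "B \<subseteq> K" "pairwise orthogonal B" "\<And>x. x \<in> B \<Longrightarrow> norm x = 1"
    "independent B" "span B = K"
    using orthonormal_basis_subspace[OF assms] by metis
  have fin: "finite B" using B(4) by (rule independent_imp_finite)
  define P where "P x = (\<Sum>b\<in>B. (x \<bullet> b) *\<^sub>R b)" for x
  have lin: "linear P"
    unfolding P_def by (rule linearI) (simp_all add: inner_add_left scaleR_left_distrib sum.distrib scaleR_sum_right)
  have PK: "P x \<in> K" for x
    unfolding P_def using B(1) assms by (auto intro!: subspace_sum subspace_scale)
  have id: "P x = x" if "x \<in> K" for x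
    unfolding P_def using orthonormal_basis_expand[of B x] B fin that by auto
  have P_sym: "P x \<bullet> y = x \<bullet> P y" for x y
    unfolding P_def by (simp add: inner_sum_left inner_sum_right mult.commute inner_commute)
  have orth: "(x - P x) \<bullet> y = 0" if "y \<in> K" for x y
    using P_sym[of x y] id[OF that] by (simp add: inner_diff_left)
  have "P x = 0" if "\<And>y. y \<in> K \<Longrightarrow> x \<bullet> y = 0" for x
    using orth[OF PK, of x x] that[OF PK[of x]] by (simp add: inner_diff_left)
  with lin PK id orth that show thesis by blast
qed

lemma dim_image_isometry:
  fixes f :: "'a::euclidean_space \<Rightarrow> 'a"
  assumes "linear f" "subspace K" "\<And>x. x \<in> K \<Longrightarrow> norm (f x) = norm x"
  shows "dim (f ` K) = dim K"
proof (rule dim_image_eq[OF assms(1)])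
  have "\<forall>x\<in>K. f x = 0 \<longrightarrow> x = 0" using assms(3) by force
  then have "inj_on f K" using linear_inj_on_iff_eq_0[OF assms(1,2)] by blast
  then show "inj_on f (span K)" using assms(2) by (metis span_eq_iff)
qed

lemma sum_list_ge_member:
  fixes xs :: "real list"
  assumes "\<And>x. x \<in> set xs \<Longrightarrow> 0 \<le> x" "y \<in> set xs"
  shows "y \<le> sum_list xs"
  using assms
proof (induction xs)
  case (Cons a xs)
  then have "0 \<le> sum_list xs" by (auto intro: sum_list_nonneg)
  with Cons show ?case by force
qed simp

section \<open>Clifford generators and the products (words) of them\<close>

locale anticommuting_isometries =
  fixes g :: "'i \<Rightarrow> 'v::euclidean_space \<Rightarrow> 'v" and l :: "'i list"
  assumes dist: "distinct l"
    and lin: "i \<in> set l \<Longrightarrow> linear (g i)"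
    and skew: "i \<in> set l \<Longrightarrow> g i x \<bullet> y = - (x \<bullet> g i y)"
    and square: "i \<in> set l \<Longrightarrow> g i (g i x) = - x"
    and anticomm: "i \<in> set l \<Longrightarrow> j \<in> set l \<Longrightarrow> i \<noteq> j \<Longrightarrow> g i (g j x) = - g j (g i x)"
begin

lemma isometry: "i \<in> set l \<Longrightarrow> g i x \<bullet> g i y = x \<bullet> y"
  by (simp add: skew square)

definition invariant :: "'v set \<Rightarrow> bool" where
  "invariant X \<longleftrightarrow> subspace X \<and> (\<forall>i\<in>set l. \<forall>x\<in>X. g i x \<in> X)"

lemma invariant_subspace: "invariant X \<Longrightarrow> subspace X"
  by (simp add: invariant_def)

lemma invariantD: "invariant X \<Longrightarrow> i \<in> set l \<Longrightarrow> x \<in> X \<Longrightarrow> g i x \<in> X"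
  by (simp add: invariant_def)

lemma word_linear: "set w \<subseteq> set l \<Longrightarrow> linear (foldr g w)"
proof (induction w)
  case Nil
  then show ?case using linear_id by (simp add: id_def)
next
  case (Cons a w)
  then show ?case using linear_compose[of "foldr g w" "g a"] lin by (simp add: o_def)
qed

lemma word_isometry: "set w \<subseteq> set l \<Longrightarrow> foldr g w x \<bullet> foldr g w y = x \<bullet> y"
  by (induction w) (auto simp: isometry)

lemma word_invariant: "set w \<subseteq> set l \<Longrightarrow> invariant X \<Longrightarrow> x \<in> X \<Longrightarrow> foldr g w x \<in> X"
  by (induction w) (auto intro: invariantD)

lemma word_commute_notin:
  assumes "set w \<subseteq> set l" "j \<in> set l" "j \<notin> set w"
  shows "g j (foldr g w x) = (-1) ^ length w *\<^sub>R foldr g w (g j x)"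
  using assms
proof (induction w)
  case (Cons a w)
  then have "g j (foldr g (a # w) x) = - g a (g j (foldr g w x))"
    using anticomm[of j a] by auto
  also have "\<dots> = - g a ((-1) ^ length w *\<^sub>R foldr g w (g j x))"
    using Cons by simp
  finally show ?case using Cons.prems lin[of a] by (simp add: linear_cmul)
qed simp

text \<open>The letter \<open>j\<close> occurs exactly once in \<open>w\<close>: it passes its own
  occurrence without a sign and anticommutes with the other \<open>length w - 1\<close>
  letters.\<close>

lemma word_commute_in:
  assumes "set w \<subseteq> set l" "distinct w" "j \<in> set w"
  shows "g j (foldr g w x) = - ((-1) ^ length w) *\<^sub>R foldr g w (g j x)"
  using assms
proof (induction w)
  case (Cons a w)
  show ?case
  proof (cases "a = j")
    case True
    then have j: "j \<in> set l" using Cons.prems by simp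
    have "foldr g w (g j x) = (-1) ^ length w *\<^sub>R g j (foldr g w x)"
      using word_commute_notin[of w j x] Cons.prems True
      by (cases "even (length w)") simp_all
    then have "g j (foldr g w (g j x)) = - ((-1) ^ length w) *\<^sub>R foldr g w x"
      using square[OF j] by (simp add: linear_cmul[OF lin[OF j]])
    then show ?thesis using True square[OF j]
      by (cases "even (length w)") simp_all
  next
    case False
    then have "g j (foldr g (a # w) x) = - g a (g j (foldr g w x))"
      using Cons.prems anticomm[of j a] by auto
    also have "\<dots> = - g a (- ((-1) ^ length w) *\<^sub>R foldr g w (g j x))"
      using Cons False by simp
    finally show ?thesis using Cons.prems lin[of a] by (simp add: linear_cmul linear_neg)
  qed
qed simp

text \<open>Moving the head letter through the tail of length \<open>n\<close> costs
  \<open>(-1) ^ n\<close>, and its square contributes another \<open>-1\<close>. The resulting signs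
  have period 4 in the length.\<close>

lemma word_square:
  assumes "set w \<subseteq> set l" "distinct w"
  shows "foldr g w (foldr g w x) = (if length w mod 4 \<in> {0, 3} then x else - x)"
  using assms
proof (induction w arbitrary: x)
  case (Cons a w)
  then have a: "linear (g a)" and w: "set w \<subseteq> set l" "a \<in> set l" "a \<notin> set w" by (auto simp: lin)
  have W: "linear (foldr g w)" using word_linear w by blast
  have "foldr g w (g a y) = (-1) ^ length w *\<^sub>R g a (foldr g w y)" for y
    using word_commute_notin[OF w, of y] by (cases "even (length w)") simp_all
  then have "foldr g (a # w) (foldr g (a # w) x) = (-1) ^ length w *\<^sub>R g a (g a (foldr g w (foldr g w x)))"
    using a by (simp add: linear_cmul)
  also have "\<dots> = - ((-1) ^ length w) *\<^sub>R foldr g w (foldr g w x)"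
    using w by (simp add: square)
  finally have eq: "foldr g (a # w) (foldr g (a # w) x) = - ((-1) ^ length w) *\<^sub>R foldr g w (foldr g w x)" .
  have IH: "foldr g w (foldr g w x) = (if length w mod 4 \<in> {0, 3} then x else - x)"
    using Cons by auto
  have "even (length w) \<and> length w mod 4 = 0 \<and> Suc (length w) mod 4 = 1 \<or>
      odd (length w) \<and> length w mod 4 = 1 \<and> Suc (length w) mod 4 = 2 \<or>
      even (length w) \<and> length w mod 4 = 2 \<and> Suc (length w) mod 4 = 3 \<or>
      odd (length w) \<and> length w mod 4 = 3 \<and> Suc (length w) mod 4 = 0" by presburger
  then show ?case unfolding eq IH by (elim disjE conjE) (simp_all del: foldr.simps)
qed simp

text \<open>An isometry whose square is \<open>1\<close> is symmetric, and one whose square is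
  \<open>-1\<close> is skew.\<close>

lemma word_adjoint:
  assumes "set w \<subseteq> set l" "distinct w"
  shows "foldr g w x \<bullet> y = (if length w mod 4 \<in> {0, 3} then x \<bullet> foldr g w y else - (x \<bullet> foldr g w y))"
  using word_isometry[OF assms(1), of "foldr g w x" y] word_square[OF assms, of x]
  by (auto split: if_splits)

section \<open>Traces of words and averaged intertwiners\<close>

lemma trace_eq_0_if_anticommutes:
  assumes B: "finite B" "pairwise orthogonal B" "\<And>b. b \<in> B \<Longrightarrow> norm b = 1"
    and X: "invariant (span B)" and T: "linear T" "\<And>x. x \<in> span B \<Longrightarrow> T x \<in> span B"
    and j: "j \<in> set l" and anti: "\<And>x. x \<in> span B \<Longrightarrow> T (g j x) = - g j (T x)"
  shows "(\<Sum>b\<in>B. T b \<bullet> b) = 0"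
proof -
  have expand: "(\<Sum>b\<in>B. (x \<bullet> b) *\<^sub>R b) = x" if "x \<in> span B" for x
    using orthonormal_basis_expand[of B x] B that by auto
  have gB: "g j x \<in> span B" if "x \<in> span B" for x
    using X j that by (rule invariantD)
  have gj: "linear (g j)" using j by (rule lin)
  \<comment> \<open>This expands \<open>c\<close> in the vectors \<open>g j b\<close>, which form a
    second orthonormal basis of \<open>span B\<close>.\<close>
  have inv: "(\<Sum>b\<in>B. (g j b \<bullet> c) *\<^sub>R g j b) = c" if "c \<in> B" for c
  proof -
    have "(\<Sum>b\<in>B. (g j b \<bullet> c) *\<^sub>R g j b) = - g j (\<Sum>b\<in>B. (g j c \<bullet> b) *\<^sub>R b)"
      using gj j by (simp add: linear_sum linear_cmul skew[of j] sum_negf inner_commute[of "g j c"] o_def)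
    also have "\<dots> = c"
      using expand[OF gB, of c] that j by (simp add: span_base square)
    finally show ?thesis .
  qed
  \<comment> \<open>The trace of \<open>T\<close> computed in the basis \<open>g j b\<close> is the
    negative of the trace computed in \<open>B\<close>, by anticommutation; since the trace does not
    depend on the orthonormal basis, it vanishes.\<close>
  have "- (\<Sum>b\<in>B. T b \<bullet> b) = (\<Sum>b\<in>B. T (g j b) \<bullet> g j b)"
    using anti j by (simp add: span_base isometry sum_negf)
  also have "\<dots> = (\<Sum>b\<in>B. T (g j b) \<bullet> (\<Sum>c\<in>B. (g j b \<bullet> c) *\<^sub>R c))"
    by (intro sum.cong refl) (simp add: expand gB span_base)
  also have "\<dots> = (\<Sum>b\<in>B. \<Sum>c\<in>B. (g j b \<bullet> c) * (T (g j b) \<bullet> c))"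
    by (simp add: inner_sum_right)
  also have "\<dots> = (\<Sum>c\<in>B. \<Sum>b\<in>B. (g j b \<bullet> c) * (T (g j b) \<bullet> c))"
    by (rule sum.swap)
  also have "\<dots> = (\<Sum>c\<in>B. T (\<Sum>b\<in>B. (g j b \<bullet> c) *\<^sub>R g j b) \<bullet> c)"
    using T(1) by (simp add: linear_sum linear_cmul inner_sum_left o_def)
  also have "\<dots> = (\<Sum>c\<in>B. T c \<bullet> c)"
    by (intro sum.cong refl) (simp add: inv)
  finally show ?thesis by linarith
qed

text \<open>Skew words have zero diagonal. A symmetric word anticommutes with some generator: with
  its own letters if its length is even, with a missing generator if its length is odd. The excluded
  word, the full one of length 3 mod 4, commutes with all generators.\<close>

lemma word_trace_eq_0:
  assumes B: "finite B" "pairwise orthogonal B" "\<And>b. b \<in> B \<Longrightarrow> norm b = 1"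
    and X: "invariant (span B)"
    and w: "set w \<subseteq> set l" "distinct w" "w \<noteq> []" and nonfull: "set w = set l \<Longrightarrow> length w mod 4 \<noteq> 3"
  shows "(\<Sum>b\<in>B. foldr g w b \<bullet> b) = 0"
proof (cases "length w mod 4 \<in> {0, 3}")
  case False
  have "foldr g w b \<bullet> b = 0" for b
    using word_adjoint[OF w(1,2), of b b] False inner_commute[of b "foldr g w b"] by auto
  then show ?thesis by simp
next
  case True
  have "\<exists>j\<in>set l. \<forall>x. foldr g w (g j x) = - g j (foldr g w x)"
  proof (cases "even (length w)")
    case True
    have "hd w \<in> set w" using w(3) by simp
    with word_commute_in[OF w(1,2)] True w(1) show ?thesis
      by (intro bexI[of _ "hd w"]) auto
  next
    case False
    then have "length w mod 4 \<noteq> 0" by presburger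
    with True have "length w mod 4 = 3" by simp
    with nonfull w(1) obtain j where "j \<in> set l" "j \<notin> set w" by blast
    with word_commute_notin[OF w(1)] False show ?thesis
      by (intro bexI[of _ j]) auto
  qed
  then obtain j where "j \<in> set l" "\<And>x. foldr g w (g j x) = - g j (foldr g w x)" by blast
  with trace_eq_0_if_anticommutes[OF B X word_linear[OF w(1)] word_invariant[OF w(1) X]]
  show ?thesis by blast
qed

text \<open>With \<open>W = foldr g w\<close>, each summand is the rank one map
  \<open>x \<mapsto> (x \<bullet> a) b\<close> conjugated by the isometry \<open>W\<close>. The
  subsequences of \<open>k\<close> represent the group generated by its letters up to sign, and
  signs cancel under conjugation, so this is an unnormalised group average.\<close>

definition avg :: "'i list \<Rightarrow> 'v \<Rightarrow> 'v \<Rightarrow> 'v \<Rightarrow> 'v" where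
  "avg k a b x = (\<Sum>w\<leftarrow>subseqs k. (x \<bullet> foldr g w a) *\<^sub>R foldr g w b)"

lemma subseqs_mem_subset: "w \<in> set (subseqs k) \<Longrightarrow> set w \<subseteq> set k"
  using subseqs_powset[of k] by blast

lemma avg_Nil: "avg [] a b x = (x \<bullet> a) *\<^sub>R b"
  by (simp add: avg_def)

text \<open>A subsequence of \<open>i # k\<close> either omits \<open>i\<close> or starts with it;
  those of the second kind contribute the average over \<open>k\<close> conjugated by
  \<open>g i\<close>. The minus sign arises because \<open>- g i\<close> is the inverse of
  \<open>g i\<close>.\<close>

lemma avg_Cons:
  assumes "set (i # k) \<subseteq> set l"
  shows "avg (i # k) a b x = avg k a b x - g i (avg k a b (g i x))"
proof -
  have i: "i \<in> set l" "linear (g i)" using assms lin by auto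
  have "g i (\<Sum>w\<leftarrow>ws. (g i x \<bullet> foldr g w a) *\<^sub>R foldr g w b) =
      - (\<Sum>w\<leftarrow>ws. (x \<bullet> foldr g (i # w) a) *\<^sub>R foldr g (i # w) b)" for ws
    by (induction ws) (use i in \<open>simp_all add: linear_add linear_cmul linear_0 linear_diff linear_neg skew\<close>)
  then show ?thesis
    by (simp add: avg_def Let_def o_def)
qed

lemma avg_linear: "set k \<subseteq> set l \<Longrightarrow> linear (avg k a b)"
proof (induction k)
  case Nil
  show ?case by (rule linearI) (simp_all add: avg_Nil inner_add_left scaleR_left_distrib)
next
  case (Cons i k)
  then have k: "linear (avg k a b)" and i: "linear (g i)" using lin by auto
  have "linear (\<lambda>x. avg k a b x - g i (avg k a b (g i x)))"
    using linear_compose_sub[OF k linear_compose[OF linear_compose[OF i k] i]] by (simp add: o_def)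
  then show ?case unfolding avg_Cons[OF Cons.prems, abs_def] .
qed

text \<open>For the head letter, \<open>A - g A g\<close> commutes with \<open>g\<close> because
  \<open>g\<close> squares to \<open>-1\<close>. For a later letter the induction hypothesis
  applies, and the two sign changes in the conjugated term cancel.\<close>

lemma avg_intertwines:
  assumes "set k \<subseteq> set l" "j \<in> set k"
  shows "avg k a b (g j x) = g j (avg k a b x)"
  using assms
proof (induction k arbitrary: x)
  case (Cons i k)
  have L: "linear (avg k a b)" "linear (g i)" "linear (g j)" "i \<in> set l" "j \<in> set l"
    using Cons.prems avg_linear lin by auto
  show ?case
  proof (cases "i = j")
    case True
    then show ?thesis
      using L avg_Cons[OF Cons.prems(1), of a b] by (simp add: square linear_diff linear_neg)
  next
    case False
    then have IH: "avg k a b (g j y) = g j (avg k a b y)" for y using Cons by auto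
    have "avg (i # k) a b (g j x) = g j (avg k a b x) - g i (avg k a b (g i (g j x)))"
      by (simp add: avg_Cons[OF Cons.prems(1)] IH)
    also have "g i (g j x) = - g j (g i x)" using L False by (intro anticomm)
    finally show ?thesis
      using L False anticomm[of i j "avg k a b (g i x)"]
      by (simp add: avg_Cons[OF Cons.prems(1)] IH linear_neg linear_diff)
  qed
qed simp

lemma avg_in:
  assumes "invariant Y" "b \<in> Y" "set k \<subseteq> set l"
  shows "avg k a b x \<in> Y"
  using assms(3)
proof (induction k arbitrary: x)
  case Nil
  then show ?case using assms by (simp add: avg_Nil invariant_subspace subspace_scale)
next
  case (Cons i k)
  then show ?case using assms
    by (simp add: avg_Cons invariant_subspace invariantD subspace_diff)
qed

text \<open>For length 3 mod 4 the full word commutes with all generators and is an involution, so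
  there is no nonzero intertwiner between modules on which it acts with opposite signs. A common
  scalar excludes this; for other lengths the condition is vacuous.\<close>

definition compatible :: "'v set \<Rightarrow> 'v set \<Rightarrow> bool" where
  "compatible X Y \<longleftrightarrow> (length l mod 4 = 3 \<longrightarrow> (\<exists>\<epsilon>. \<forall>x\<in>X \<union> Y. foldr g l x = \<epsilon> *\<^sub>R x))"

lemma compatible_mono: "compatible X Y \<Longrightarrow> X' \<subseteq> X \<Longrightarrow> Y' \<subseteq> Y \<Longrightarrow> compatible X' Y'"
  unfolding compatible_def by blast

text \<open>Summing matrix entries of the averages over orthonormal bases of \<open>X\<close> and
  \<open>Y\<close> gives the sum of products of traces of words on \<open>X\<close> and
  \<open>Y\<close>. The empty word contributes a positive term and no word a negative one, so some
  average is nonzero.\<close>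

lemma nonzero_intertwiner:
  assumes X: "invariant X" "X \<noteq> {0}" and Y: "invariant Y" "Y \<noteq> {0}" and XY: "compatible X Y"
  obtains a b x where "b \<in> Y" "x \<in> X" "avg l a b x \<noteq> 0"
proof -
  obtain B where B: "B \<subseteq> X" "pairwise orthogonal B" "\<And>x. x \<in> B \<Longrightarrow> norm x = 1"
      "independent B" "span B = X"
    using orthonormal_basis_subspace[OF invariant_subspace[OF X(1)]] by metis
  obtain C where C: "C \<subseteq> Y" "pairwise orthogonal C" "\<And>x. x \<in> C \<Longrightarrow> norm x = 1"
      "independent C" "span C = Y"
    using orthonormal_basis_subspace[OF invariant_subspace[OF Y(1)]] by metis
  have fin: "finite B" "finite C" using B(4) C(4) independent_imp_finite by auto
  have ne: "B \<noteq> {}" "C \<noteq> {}" using X(2) B(5) Y(2) C(5) by auto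
  define tr where "tr D w = (\<Sum>b\<in>D. foldr g w b \<bullet> b)" for D w
  have nonneg: "tr B w * tr C w \<ge> 0" if w: "w \<in> set (subseqs l)" for w
  proof -
    have wl: "set w \<subseteq> set l" "distinct w"
      using w subseqs_mem_subset subseqs_distinctD[OF w dist] by auto
    consider "w = []" | "w \<noteq> []" "set w = set l \<Longrightarrow> length w mod 4 \<noteq> 3" | "set w = set l" "length w mod 4 = 3" by blast
    then show ?thesis
    proof cases
      case 1
      then show ?thesis by (simp add: tr_def sum_nonneg)
    next
      case 2
      then have "tr B w = 0"
        unfolding tr_def using word_trace_eq_0[OF fin(1) B(2,3) _ wl] B(5) X(1) by simp
      then show ?thesis by simp
    next
      case 3
      \<comment> \<open>Subsequences of a distinct list are determined by their sets of
        letters.\<close>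
      then have "w = l" using w subseqs_refl[of l] distinct_set_subseqs[OF dist]
        by (auto simp: distinct_map dest: inj_onD)
      then obtain \<epsilon> where "\<forall>x\<in>X \<union> Y. foldr g w x = \<epsilon> *\<^sub>R x"
        using XY 3 unfolding compatible_def by blast
      then have "tr B w = \<epsilon> * card B" "tr C w = \<epsilon> * card C"
        unfolding tr_def using B(1,3) C(1,3)
        by (simp_all add: subset_iff dot_square_norm)
      then have "tr B w * tr C w = \<epsilon>\<^sup>2 * (card B * card C)" by (simp add: power2_eq_square)
      then show ?thesis by simp
    qed
  qed
  have "tr B [] = card B" "tr C [] = card C"
    unfolding tr_def using B(3) C(3) by (simp_all add: dot_square_norm)
  then have "0 < tr B [] * tr C []" using fin ne by (simp add: card_gt_0_iff)
  moreover have "[] \<in> set (subseqs l)" by (induction l) (auto simp: Let_def)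
  ultimately have pos: "0 < (\<Sum>w\<leftarrow>subseqs l. tr B w * tr C w)"
    using sum_list_ge_member[of "map (\<lambda>w. tr B w * tr C w) (subseqs l)" "tr B [] * tr C []"] nonneg by force
  have "(\<Sum>a\<in>B. \<Sum>b\<in>C. (\<Sum>w\<leftarrow>ws. (a \<bullet> foldr g w a) *\<^sub>R foldr g w b) \<bullet> b) =
      (\<Sum>w\<leftarrow>ws. tr B w * tr C w)" for ws
  proof (induction ws)
    case (Cons w ws)
    have "(\<Sum>a\<in>B. \<Sum>b\<in>C. (a \<bullet> foldr g w a) * (foldr g w b \<bullet> b)) = tr B w * tr C w"
      unfolding tr_def by (simp add: sum_product inner_commute)
    with Cons show ?case by (simp add: inner_add_left sum.distrib)
  qed simp
  then have "(\<Sum>a\<in>B. \<Sum>b\<in>C. avg l a b a \<bullet> b) \<noteq> 0"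
    using pos by (simp add: avg_def)
  then obtain a b where "a \<in> B" "b \<in> C" "avg l a b a \<bullet> b \<noteq> 0"
    by (meson sum.neutral)
  moreover from this(3) have "avg l a b a \<noteq> 0" by auto
  ultimately show thesis using that[of b a a] B(1) C(1) by blast
qed

text \<open>The vectors that are stretched maximally by a nonzero intertwiner form an invariant subspace
  on which the intertwiner is a multiple of an isometry.\<close>

lemma partial_isometric_intertwiner:
  assumes X: "invariant X" "X \<noteq> {0}" and Y: "invariant Y" "Y \<noteq> {0}" and XY: "compatible X Y"
  obtains A K where "linear A" "invariant K" "K \<subseteq> X" "K \<noteq> {0}" "A ` K \<subseteq> Y"
    "\<And>x. x \<in> K \<Longrightarrow> norm (A x) = norm x"
    "\<And>i x. i \<in> set l \<Longrightarrow> A (g i x) = g i (A x)"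
proof -
  obtain a b x0 where b: "b \<in> Y" and x0: "x0 \<in> X" "avg l a b x0 \<noteq> 0"
    using nonzero_intertwiner[OF assms] .
  define M where "M = avg l a b"
  have M: "linear M" and MY: "M x \<in> Y" and Mg: "i \<in> set l \<Longrightarrow> M (g i x) = g i (M x)" for x i
    using avg_linear avg_in[OF Y(1) b] avg_intertwines unfolding M_def by auto
  have sX: "subspace X" using X(1) by (rule invariant_subspace)
  define S where "S = X \<inter> sphere 0 1"
  have "compact S" unfolding S_def using closed_subspace[OF sX] by (simp add: closed_Int_compact)
  moreover have x0n: "x0 \<noteq> 0" using x0 M linear_0 unfolding M_def by metis
  have unit: "x /\<^sub>R norm x \<in> S" if "x \<in> X" "x \<noteq> 0" for x
    unfolding S_def using that sX by (simp add: subspace_scale)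
  have "S \<noteq> {}" using unit[OF x0(1) x0n] by auto
  moreover have "continuous_on S (\<lambda>x. norm (M x))"
    using M by (intro continuous_on_norm linear_continuous_on linear_conv_bounded_linear[THEN iffD1])
  ultimately obtain s where s: "s \<in> S" "\<And>x. x \<in> S \<Longrightarrow> norm (M x) \<le> norm (M s)"
    using continuous_attains_sup[of S "\<lambda>x. norm (M x)"] by blast
  define c where "c = norm (M s)"
  have bound: "norm (M x) \<le> c * norm x" if "x \<in> X" for x
  proof (cases "x = 0")
    case False
    then show ?thesis using s(2)[OF unit[OF that False]] M
      by (simp add: linear_cmul c_def field_simps)
  qed (use M in \<open>simp add: linear_0\<close>)
  have "0 < norm (M x0)" using x0 by (simp add: M_def)
  with bound[OF x0(1)] have "0 < c * norm x0" by linarith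
  then have c: "c > 0" using x0n by (simp add: zero_less_mult_iff)
  \<comment> \<open>A quadratic form, nonnegative on \<open>X\<close>, that vanishes exactly at the
    maximally stretched vectors. By the parallelogram identity, \<open>q (x + y)\<close> and
    \<open>q (x - y)\<close> sum to zero when \<open>q x\<close> and \<open>q y\<close> vanish, so
    its zeros in \<open>X\<close> form a subspace.\<close>
  define q where "q x = c\<^sup>2 * (x \<bullet> x) - M x \<bullet> M x" for x
  have q0: "q x \<ge> 0" if "x \<in> X" for x
    using power_mono[OF bound[OF that], of 2] by (simp add: q_def power_mult_distrib power2_norm_eq_inner)
  have qiff: "q x = 0 \<longleftrightarrow> norm (M x) = c * norm x" for x
  proof -
    have "q x = 0 \<longleftrightarrow> (norm (M x))\<^sup>2 = (c * norm x)\<^sup>2"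
      by (auto simp: q_def power_mult_distrib power2_norm_eq_inner)
    then show ?thesis using c by (simp add: power2_eq_iff_nonneg)
  qed
  define K where "K = {x \<in> X. q x = 0}"
  have "subspace K"
  proof (rule subspaceI)
    show "0 \<in> K" using sX M by (simp add: K_def q_def subspace_0 linear_0)
    show "x + y \<in> K" if "x \<in> K" "y \<in> K" for x y
    proof -
      have "q (x + y) + q (x - y) = 2 * q x + 2 * q y"
        unfolding q_def using M by (simp add: linear_add linear_diff inner_simps inner_commute algebra_simps)
      moreover have "x + y \<in> X" "x - y \<in> X" using that sX by (auto simp: K_def subspace_add subspace_diff)
      ultimately show ?thesis using that q0[of "x + y"] q0[of "x - y"] by (simp add: K_def)
    qed
    show "r *\<^sub>R x \<in> K" if "x \<in> K" for r x
    proof -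
      have "q (r *\<^sub>R x) = r\<^sup>2 * q x"
        unfolding q_def using M by (simp add: linear_cmul power2_eq_square algebra_simps)
      with that sX show ?thesis by (simp add: K_def subspace_scale)
    qed
  qed
  moreover have "g i x \<in> K" if "i \<in> set l" "x \<in> K" for i x
    using that invariantD[OF X(1)] by (simp add: K_def q_def isometry Mg)
  ultimately have K: "invariant K" by (simp add: invariant_def)
  have "s \<in> K" "s \<noteq> 0" using s(1) qiff[of s] by (auto simp: K_def S_def c_def)
  then have Kn: "K \<noteq> {0}" by auto
  \<comment> \<open>Rescaling by the maximal stretch \<open>c\<close> makes the intertwiner
    isometric on \<open>K\<close>.\<close>
  define A where "A x = inverse c *\<^sub>R M x" for x
  have "linear A" unfolding A_def using M by (rule linear_compose_scale_right)
  moreover have "A ` K \<subseteq> Y" unfolding A_def using MY Y(1) by (auto simp: invariant_subspace subspace_scale)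
  moreover have "norm (A x) = norm x" if "x \<in> K" for x
    using that c qiff[of x] by (simp add: A_def K_def)
  moreover have "A (g i x) = g i (A x)" if "i \<in> set l" for i x
    using that lin by (simp add: A_def Mg linear_cmul)
  ultimately show thesis using that[of A K] K Kn unfolding K_def by blast
qed

section \<open>Isometric isomorphisms and classification by dimension\<close>

definition isometric_iso :: "('v \<Rightarrow> 'v) \<Rightarrow> 'v set \<Rightarrow> 'v set \<Rightarrow> bool" where
  "isometric_iso f X Y \<longleftrightarrow> linear f \<and> (\<forall>x\<in>X. norm (f x) = norm x) \<and> f ` X = Y \<and>
     (\<forall>i\<in>set l. \<forall>x\<in>X. f (g i x) = g i (f x))"

definition ocomp :: "'v set \<Rightarrow> 'v set \<Rightarrow> 'v set" where
  "ocomp X K = {x \<in> X. \<forall>y\<in>K. orthogonal y x}"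

lemma ocomp_dim:
  assumes "subspace X" "subspace K" "K \<subseteq> X"
  shows "dim (ocomp X K) + dim K = dim X"
  using dim_subspace_orthogonal_to_vectors[OF assms(2,1,3)] by (simp add: ocomp_def)

text \<open>Skew generators can be moved across the inner product, so orthogonal complements give
  complete reducibility.\<close>

lemma ocomp_invariant:
  assumes "invariant X" "invariant K"
  shows "invariant (ocomp X K)"
proof -
  have "subspace (ocomp X K)"
    using invariant_subspace[OF assms(1)] unfolding ocomp_def subspace_def
    by (auto simp: orthogonal_clauses)
  moreover have "g i x \<in> ocomp X K" if "i \<in> set l" "x \<in> ocomp X K" for i x
  proof -
    have "y \<bullet> g i x = 0" if "y \<in> K" for y
      using skew[OF \<open>i \<in> set l\<close>, of y x] invariantD[OF assms(2) \<open>i \<in> set l\<close> that]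
        \<open>x \<in> ocomp X K\<close> by (auto simp: ocomp_def orthogonal_def)
    then show ?thesis using that invariantD[OF assms(1) that(1)] by (simp add: ocomp_def orthogonal_def)
  qed
  ultimately show ?thesis by (simp add: invariant_def)
qed

lemma isometric_iso_invariant:
  assumes "isometric_iso f X Y" "invariant X"
  shows "invariant Y"
proof -
  have f: "linear f" "f ` X = Y" "\<And>i x. i \<in> set l \<Longrightarrow> x \<in> X \<Longrightarrow> g i (f x) = f (g i x)"
    using assms(1) by (auto simp: isometric_iso_def)
  have "subspace Y" using f invariant_subspace[OF assms(2)] linear_subspace_image by blast
  moreover have "g i y \<in> Y" if "i \<in> set l" "y \<in> Y" for i y
    using that f invariantD[OF assms(2)] by force
  ultimately show ?thesis by (simp add: invariant_def)
qed

text \<open>The two isomorphisms act on orthogonal summands and have orthogonal images, so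
  Pythagoras gives the norm. The orthogonal projection onto \<open>K\<close> makes the combined map
  linear on the whole space.\<close>

lemma isometric_iso_combine:
  assumes X: "invariant X" and Y: "invariant Y" and K: "invariant K" "K \<subseteq> X" and N: "N \<subseteq> Y"
    and f1: "isometric_iso f1 K N" and f2: "isometric_iso f2 (ocomp X K) (ocomp Y N)"
  obtains f where "isometric_iso f X Y"
proof -
  have sX: "subspace X" and sK: "subspace K" using X K invariant_subspace by auto
  have N': "subspace N" using isometric_iso_invariant[OF f1 K(1)] by (rule invariant_subspace)
  note sY = invariant_subspace[OF Y]
  obtain P where P: "linear P" "\<And>x. P x \<in> K" "\<And>x y. y \<in> K \<Longrightarrow> (x - P x) \<bullet> y = 0"
    "\<And>x. x \<in> K \<Longrightarrow> P x = x" "\<And>x. (\<And>y. y \<in> K \<Longrightarrow> x \<bullet> y = 0) \<Longrightarrow> P x = 0"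
    using orthogonal_projection_exists[OF sK] by blast
  obtain Q where Q: "linear Q" "\<And>x. Q x \<in> N" "\<And>x y. y \<in> N \<Longrightarrow> (x - Q x) \<bullet> y = 0"
    using orthogonal_projection_exists[OF N'] by metis
  define f where "f x = f1 (P x) + f2 (x - P x)" for x
  have L: "linear f1" "linear f2" using f1 f2 by (auto simp: isometric_iso_def)
  have "linear (\<lambda>x. f2 (x - P x))"
    using linear_compose[OF linear_compose_sub[OF linear_ident P(1)] L(2)] by (simp add: o_def)
  moreover have "linear (\<lambda>x. f1 (P x))" using linear_compose[OF P(1) L(1)] by (simp add: o_def)
  ultimately have lf: "linear f" unfolding f_def by (intro linear_compose_add)
  have split: "P x \<in> K" "x - P x \<in> ocomp X K" if "x \<in> X" for x
    using P(2,3) that K(2) sX by (auto simp: ocomp_def orthogonal_def inner_commute subspace_diff subset_iff)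
  have fsum: "f (k + k') = f1 k + f2 k'" if "k \<in> K" "k' \<in> ocomp X K" for k k'
  proof -
    have "P k' = 0" using that by (intro P(5)) (auto simp: ocomp_def orthogonal_def inner_commute)
    then have "P (k + k') = k" using P(1,4) that by (simp add: linear_add)
    then show ?thesis by (simp add: f_def)
  qed
  have nf: "norm (f x) = norm x" if "x \<in> X" for x
  proof -
    note s = split[OF that]
    have "f1 (P x) \<in> N" "f2 (x - P x) \<in> ocomp Y N" using s f1 f2 by (auto simp: isometric_iso_def)
    then have o: "orthogonal (f1 (P x)) (f2 (x - P x))" by (auto simp: ocomp_def)
    have o': "orthogonal (P x) (x - P x)" using s by (auto simp: ocomp_def)
    have "(norm (f x))\<^sup>2 = (norm (f1 (P x)))\<^sup>2 + (norm (f2 (x - P x)))\<^sup>2"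
      unfolding f_def by (rule norm_add_Pythagorean[OF o])
    also have "\<dots> = (norm (P x))\<^sup>2 + (norm (x - P x))\<^sup>2"
      using s f1 f2 by (auto simp: isometric_iso_def)
    also have "\<dots> = (norm x)\<^sup>2" using norm_add_Pythagorean[OF o'] by simp
    finally show ?thesis by (simp add: power2_eq_iff_nonneg)
  qed
  have fY: "f x \<in> Y" if "x \<in> X" for x
  proof -
    have "f1 (P x) \<in> Y" "f2 (x - P x) \<in> Y"
      using split[OF that] f1 f2 N by (auto simp: isometric_iso_def ocomp_def)
    then show ?thesis unfolding f_def using sY by (simp add: subspace_add)
  qed
  moreover have "y \<in> f ` X" if "y \<in> Y" for y
  proof -
    have "y - Q y \<in> ocomp Y N" using Q(2,3) that N sY
      by (auto simp: ocomp_def orthogonal_def inner_commute subspace_diff subset_iff)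
    then obtain k' where k': "k' \<in> ocomp X K" "f2 k' = y - Q y"
      using f2 unfolding isometric_iso_def by (metis (no_types) imageE)
    obtain k where k: "k \<in> K" "f1 k = Q y"
      using Q(2) f1 unfolding isometric_iso_def by (metis (no_types) imageE)
    have "f (k + k') = y" using fsum[OF k(1) k'(1)] k k' by simp
    moreover have "k + k' \<in> X" using k k' K(2) sX by (auto simp: ocomp_def subspace_add)
    ultimately show ?thesis by blast
  qed
  ultimately have "f ` X = Y" by auto
  moreover have "f (g i x) = g i (f x)" if "i \<in> set l" "x \<in> X" for i x
  proof -
    note s = split[OF that(2)]
    have "g i x = g i (P x) + g i (x - P x)" using lin[OF that(1)] by (simp add: linear_diff)
    then have "f (g i x) = f1 (g i (P x)) + f2 (g i (x - P x))"
      using fsum[OF invariantD[OF K(1) that(1) s(1)] invariantD[OF ocomp_invariant[OF X K(1)] that(1) s(2)]] by simp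
    also have "\<dots> = g i (f x)"
      using s f1 f2 that lin[OF that(1)] by (simp add: isometric_iso_def f_def linear_add)
    finally show ?thesis .
  qed
  ultimately show thesis using that lf nf unfolding isometric_iso_def by blast
qed

text \<open>A partial isometric intertwiner matches a nonzero \<open>K\<close> in \<open>X\<close>
  with its image in \<open>Y\<close>. The orthogonal complements have equal smaller dimensions and
  stay compatible, so induction applies.\<close>

lemma isometric_iso_exists:
  assumes "invariant X" "invariant Y" "dim X = dim Y" "compatible X Y"
  shows "\<exists>f. isometric_iso f X Y"
  using assms
proof (induction "dim X" arbitrary: X Y rule: less_induct)
  case less
  note sX = invariant_subspace[OF less.prems(1)] and sY = invariant_subspace[OF less.prems(2)]
  show ?case
  proof (cases "X = {0}")
    case True
    then have "Y = {0}" using less.prems(3) sY by (auto simp: subspace_0)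
    with True have "isometric_iso id X Y" by (simp add: isometric_iso_def linear_id)
    then show ?thesis by blast
  next
    case False
    then have "dim X \<noteq> 0" using sX by (auto simp: subspace_0)
    then have "Y \<noteq> {0}" using less.prems(3) by auto
    then obtain A K where A: "linear A" "invariant K" "K \<subseteq> X" "K \<noteq> {0}" "A ` K \<subseteq> Y"
        "\<And>x. x \<in> K \<Longrightarrow> norm (A x) = norm x"
        "\<And>i x. i \<in> set l \<Longrightarrow> A (g i x) = g i (A x)"
      using partial_isometric_intertwiner[OF less.prems(1) False less.prems(2) _ less.prems(4)] by blast
    have iso: "isometric_iso A K (A ` K)" using A by (simp add: isometric_iso_def)
    note N = isometric_iso_invariant[OF iso A(2)]
    note sK = invariant_subspace[OF A(2)]
    have dK: "dim (A ` K) = dim K" using dim_image_isometry[OF A(1) sK A(6)] .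
    have d1: "dim (ocomp X K) + dim K = dim X" by (rule ocomp_dim[OF sX sK A(3)])
    have d2: "dim (ocomp Y (A ` K)) + dim (A ` K) = dim Y"
      by (rule ocomp_dim[OF sY invariant_subspace[OF N] A(5)])
    have "dim K > 0" using A(4) sK by (auto simp: subspace_0)
    then have "dim (ocomp X K) < dim X" "dim (ocomp X K) = dim (ocomp Y (A ` K))"
      using d1 d2 dK less.prems(3) by auto
    moreover have "compatible (ocomp X K) (ocomp Y (A ` K))"
      by (rule compatible_mono[OF less.prems(4)]) (auto simp: ocomp_def)
    ultimately obtain f2 where "isometric_iso f2 (ocomp X K) (ocomp Y (A ` K))"
      using less.hyps ocomp_invariant less.prems A(2) N by blast
    then show ?thesis
      using isometric_iso_combine[OF less.prems(1,2) A(2,3,5) iso] by blast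
  qed
qed

section \<open>Simple modules and their copies\<close>

definition simple :: "'v set \<Rightarrow> bool" where
  "simple S \<longleftrightarrow> invariant S \<and> S \<noteq> {0} \<and> (\<forall>U. invariant U \<and> U \<subseteq> S \<longrightarrow> U = {0} \<or> U = S)"

text \<open>The domain of a partial isometric intertwiner is a nonzero invariant subspace of
  \<open>S\<close>, hence all of \<open>S\<close>.\<close>

lemma simple_copy:
  assumes S: "simple S" and X: "invariant X" "X \<noteq> {0}" and SX: "compatible S X"
  obtains N where "N \<subseteq> X" "invariant N" "dim N = dim S"
proof -
  have iS: "invariant S" "S \<noteq> {0}" using S by (auto simp: simple_def)
  obtain A K where A: "linear A" "invariant K" "K \<subseteq> S" "K \<noteq> {0}" "A ` K \<subseteq> X"
      "\<And>x. x \<in> K \<Longrightarrow> norm (A x) = norm x" "\<And>i x. i \<in> set l \<Longrightarrow> A (g i x) = g i (A x)"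
    using partial_isometric_intertwiner[OF iS X SX] by blast
  have KS: "K = S" using S A(2,3,4) by (auto simp: simple_def)
  have "isometric_iso A K (A ` K)" using A by (simp add: isometric_iso_def)
  then have "invariant (A ` K)" using A(2) isometric_iso_invariant by blast
  moreover have "dim (A ` K) = dim S"
    using dim_image_isometry[OF A(1) invariant_subspace[OF A(2)] A(6)] KS by simp
  ultimately show thesis using that A(5) by blast
qed

text \<open>Splitting off copies of \<open>S\<close> and passing to orthogonal complements exhausts
  \<open>X\<close>.\<close>

lemma simple_dim_dvd:
  assumes "simple S" "invariant X" "compatible S X"
  shows "dim S dvd dim X"
  using assms(2,3)
proof (induction "dim X" arbitrary: X rule: less_induct)
  case less
  show ?case
  proof (cases "X = {0}")
    case False
    then obtain N where N: "N \<subseteq> X" "invariant N" "dim N = dim S"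
      using simple_copy[OF assms(1) less.prems(1) _ less.prems(2)] by blast
    have d: "dim (ocomp X N) + dim N = dim X"
      using ocomp_dim N less.prems(1) invariant_subspace by blast
    have "S \<noteq> {0}" "subspace S" using assms(1) by (auto simp: simple_def invariant_subspace)
    then have "dim S > 0" by (auto simp: subspace_0)
    then have "dim (ocomp X N) < dim X" using d N(3) by simp
    moreover have "compatible S (ocomp X N)"
      by (rule compatible_mono[OF less.prems(2)]) (auto simp: ocomp_def)
    ultimately have "dim S dvd dim (ocomp X N)"
      using less.hyps ocomp_invariant[OF less.prems(1) N(2)] by blast
    then show ?thesis using d N(3) by (metis dvd_add dvd_refl)
  qed simp
qed

text \<open>\<open>N\<close> is what remains of \<open>X\<close> after \<open>k\<close> copies of
  \<open>S\<close> have been split off.\<close>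

lemma invariant_subspace_of_codim:
  assumes "simple S" "invariant X" "compatible S X" "k * dim S \<le> dim X"
  shows "\<exists>N\<subseteq>X. invariant N \<and> dim N + k * dim S = dim X"
  using assms(2-)
proof (induction k arbitrary: X)
  case (Suc k)
  have "S \<noteq> {0}" "subspace S" using assms(1) by (auto simp: simple_def invariant_subspace)
  then have "dim S > 0" by (auto simp: subspace_0)
  then have "0 < dim X" using Suc.prems(3) by (auto intro: less_le_trans simp del: dim_eq_0)
  then have "X \<noteq> {0}" by auto
  then obtain N where N: "N \<subseteq> X" "invariant N" "dim N = dim S"
    using simple_copy[OF assms(1) Suc.prems(1) _ Suc.prems(2)] by blast
  have d: "dim (ocomp X N) + dim N = dim X"
    using ocomp_dim N Suc.prems(1) invariant_subspace by blast
  have "compatible S (ocomp X N)"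
    by (rule compatible_mono[OF Suc.prems(2)]) (auto simp: ocomp_def)
  then obtain N' where "N' \<subseteq> ocomp X N" "invariant N'" "dim N' + k * dim S = dim (ocomp X N)"
    using Suc.IH[OF ocomp_invariant[OF Suc.prems(1) N(2)]] Suc.prems(3) d N(3) by auto
  then show ?case using d N(3) by (intro exI[of _ N']) (auto simp: ocomp_def)
qed auto

end

section \<open>Heisenberg type modules and the even Clifford algebra\<close>

locale htype_module =
  fixes J :: "'z::euclidean_space \<Rightarrow> 'v::euclidean_space \<Rightarrow> 'v" and e :: 'z and l :: "'z list"
  assumes H: "htype J" and e: "e \<in> Basis" and l: "distinct l" "set l = Basis - {e}"
begin

lemma J_linear: "linear (J z)" and J_linear_left: "linear (\<lambda>z. J z u)"
  and J_square: "J z (J z u) = - (z \<bullet> z) *\<^sub>R u" and J_skew: "J z u \<bullet> w = - (u \<bullet> J z w)"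
  using H by (auto simp: htype_def)

lemma J_simps:
  "J z (x + y) = J z x + J z y" "J z (x - y) = J z x - J z y" "J z (- x) = - J z x"
  "J z (r *\<^sub>R x) = r *\<^sub>R J z x" "J z 0 = 0"
  using J_linear by (auto simp: linear_add linear_diff linear_neg linear_cmul linear_0)

text \<open>Polarisation of \<open>J_square\<close> at \<open>z + w\<close>.\<close>

lemma J_clifford: "J z (J w u) + J w (J z u) = - (2 * (z \<bullet> w)) *\<^sub>R u"
proof -
  have add: "J (z + w) y = J z y + J w y" for y
    using linear_add[OF J_linear_left] .
  have "J (z + w) (J (z + w) u) = - ((z + w) \<bullet> (z + w)) *\<^sub>R u" by (rule J_square)
  moreover have "J (z + w) (J (z + w) u) = (J z (J w u) + J w (J z u)) + (J z (J z u) + J w (J w u))"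
    by (simp only: add J_simps) (simp add: ac_simps)
  ultimately have "J z (J w u) + J w (J z u) = - ((z + w) \<bullet> (z + w)) *\<^sub>R u - (J z (J z u) + J w (J w u))"
    by (simp add: eq_diff_eq)
  also have "\<dots> = (- ((z + w) \<bullet> (z + w)) + z \<bullet> z + w \<bullet> w) *\<^sub>R u"
    by (simp only: J_square scaleR_left_distrib scaleR_minus_left) simp
  also have "- ((z + w) \<bullet> (z + w)) + z \<bullet> z + w \<bullet> w = - (2 * (z \<bullet> w))"
    by (simp add: inner_simps inner_commute)
  finally show ?thesis .
qed

lemma J_anticommute: "z \<bullet> w = 0 \<Longrightarrow> J z (J w u) = - J w (J z u)"
  using J_clifford[of z w u] by (simp add: eq_neg_iff_add_eq_0)

lemma e_simps [simp]: "e \<bullet> e = 1" "J e (J e x) = - x"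
  using e J_square[of e x] by auto

lemma Je_isometry: "J e x \<bullet> J e y = x \<bullet> y"
  by (simp add: J_skew)

lemma dim_Je_image: "subspace X \<Longrightarrow> dim (J e ` X) = dim X"
  by (rule dim_image_isometry[OF J_linear]) (simp_all add: norm_eq_sqrt_inner Je_isometry)

text \<open>The products \<open>J\<^sub>e J\<^sub>b\<close> generate the even Clifford algebra, and as \<open>b\<close> runs through
  the other basis vectors they satisfy the Clifford relations of rank \<open>m - 1\<close>.\<close>

definition G :: "'z \<Rightarrow> 'v \<Rightarrow> 'v" where "G b x = J e (J b x)"

lemma Je_G: "b \<in> set l \<Longrightarrow> J e (G b x) = - G b (J e x)"
  using J_anticommute[of b e x] e l by (simp add: G_def J_simps inner_Basis)

sublocale anticommuting_isometries G l
proof (rule anticommuting_isometries.intro)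
  show "distinct l" by (rule l(1))
next
  fix b :: 'z and x y :: 'v
  assume b: "b \<in> set l"
  then have be: "b \<bullet> e = 0" "b \<bullet> b = 1" using e l by (auto simp: inner_Basis)
  have comm: "J b (J e x) = - J e (J b x)" for x by (rule J_anticommute[OF be(1)])
  show "linear (G b)" unfolding G_def by (rule linear_compose[OF J_linear J_linear, unfolded o_def])
  show "G b x \<bullet> y = - (x \<bullet> G b y)" unfolding G_def by (simp add: J_skew comm)
  show "G b (G b x) = - x"
    unfolding G_def using J_square[of b x] be by (simp add: comm J_simps)
  fix c assume c: "c \<in> set l" "b \<noteq> c"
  then have "c \<bullet> e = 0" "b \<bullet> c = 0" using e b l by (auto simp: inner_Basis)
  then have "J c (J e x) = - J e (J c x)" "J b (J c x) = - J c (J b x)" for x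
    by (simp_all add: J_anticommute)
  then show "G b (G c x) = - G c (G b x)" unfolding G_def by (simp add: comm J_simps)
qed

lemma J_expand: "J z x = (\<Sum>b\<in>Basis. (z \<bullet> b) *\<^sub>R J b x)"
proof -
  have "J z x = J (\<Sum>b\<in>Basis. (z \<bullet> b) *\<^sub>R b) x" by (simp add: euclidean_representation)
  also have "\<dots> = (\<Sum>b\<in>Basis. J ((z \<bullet> b) *\<^sub>R b) x)" by (rule linear_sum[OF J_linear_left])
  also have "\<dots> = (\<Sum>b\<in>Basis. (z \<bullet> b) *\<^sub>R J b x)" by (intro sum.cong refl linear_cmul[OF J_linear_left])
  finally show ?thesis .
qed

text \<open>The \<open>e\<close>-component of \<open>z\<close> contributes \<open>J e\<close>
  squared, that is \<open>-1\<close>. Thus each \<open>J e (J z x)\<close> is a combination of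
  \<open>x\<close> and the \<open>G b x\<close>, which carries invariance and intertwining from the
  generators to all \<open>z\<close>.\<close>

lemma JeJ_expand: "J e (J z x) = - (z \<bullet> e) *\<^sub>R x + (\<Sum>b\<in>set l. (z \<bullet> b) *\<^sub>R G b x)"
proof -
  have "J z x = (\<Sum>b\<in>Basis. (z \<bullet> b) *\<^sub>R J b x)" by (rule J_expand)
  also have "\<dots> = (z \<bullet> e) *\<^sub>R J e x + (\<Sum>b\<in>set l. (z \<bullet> b) *\<^sub>R J b x)"
    using e by (simp add: l sum.remove)
  finally show ?thesis
    using J_linear[of e] by (simp add: J_simps linear_sum G_def o_def)
qed

lemma JJe_expand: "J z (J e x) = - J e (J z x) - (2 * (z \<bullet> e)) *\<^sub>R x"
  using J_clifford[of z e x] by (simp add: algebra_simps eq_neg_iff_add_eq_0)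

lemma invariant_JeJ:
  assumes "invariant X" "x \<in> X"
  shows "J e (J z x) \<in> X" "J z (J e x) \<in> X"
proof -
  note sX = invariant_subspace[OF assms(1)]
  show *: "J e (J z x) \<in> X"
    unfolding JeJ_expand using assms invariantD[OF assms(1)] sX
    by (intro subspace_add subspace_sum subspace_scale) auto
  show "J z (J e x) \<in> X"
    unfolding JJe_expand using * assms sX
    by (intro subspace_diff subspace_scale subspace_neg) auto
qed

lemma intertwiner_JeJ:
  assumes "linear f" "\<And>b. b \<in> set l \<Longrightarrow> f (G b x) = G b (f x)"
  shows "f (J e (J z x)) = J e (J z (f x))" "f (J z (J e x)) = J z (J e (f x))"
proof -
  show *: "f (J e (J z x)) = J e (J z (f x))"
    unfolding JeJ_expand using assms
    by (simp add: linear_diff linear_cmul linear_sum o_def)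
  show "f (J z (J e x)) = J z (J e (f x))"
    unfolding JJe_expand using assms(1)
    by (simp add: linear_diff linear_cmul linear_neg *)
qed

section \<open>Lagrangian subspaces as modules over the even algebra\<close>

lemma hbracket_inner: "z \<bullet> hbracket J u w = J z u \<bullet> w"
  by (subst J_expand) (simp add: hbracket_def inner_sum_right inner_sum_left mult.commute)

lemma Lag_iff:
  "L \<in> Lag J \<longleftrightarrow> subspace L \<and> (\<forall>u\<in>L. \<forall>w\<in>L. \<forall>z. J z u \<bullet> w = 0) \<and> 2 * dim L = DIM('v)"
proof -
  have "hbracket J u w = 0 \<longleftrightarrow> (\<forall>z. J z u \<bullet> w = 0)" for u w
    by (metis hbracket_inner inner_eq_zero_iff inner_zero_right)
  then show ?thesis by (simp add: Lag_def)
qed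

lemma Lag_perp:
  assumes L: "L \<in> Lag J" and x: "\<And>u. u \<in> L \<Longrightarrow> u \<bullet> x = 0"
  shows "J e x \<in> L"
proof -
  have sL: "subspace L" and iso: "\<And>u w z. u \<in> L \<Longrightarrow> w \<in> L \<Longrightarrow> J z u \<bullet> w = 0"
    and d: "2 * dim L = DIM('v)" using L by (auto simp: Lag_iff)
  define C where "C = {y \<in> UNIV. \<forall>u\<in>L. orthogonal u y}"
  have "dim C + dim L = dim (UNIV :: 'v set)"
    unfolding C_def by (rule dim_subspace_orthogonal_to_vectors[OF sL]) auto
  then have dC: "dim C = dim L" using d by simp
  have sC: "subspace C"
    unfolding C_def subspace_def by (auto simp: orthogonal_clauses)
  have "J e ` L = C"
  proof (rule subspace_dim_equal)
    show "subspace (J e ` L)" using J_linear sL by (rule linear_subspace_image)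
    show "J e ` L \<subseteq> C" using iso by (auto simp: C_def orthogonal_def inner_commute)
    show "dim C \<le> dim (J e ` L)" using dC dim_Je_image[OF sL] by simp
  qed (rule sC)
  moreover have "x \<in> C" using x by (simp add: C_def orthogonal_def)
  ultimately obtain u where "u \<in> L" "x = J e u" by blast
  then show ?thesis using sL by (simp add: subspace_neg)
qed

lemma Lag_invariant:
  assumes L: "L \<in> Lag J"
  shows "invariant L"
proof -
  have "G b x \<in> L" if "x \<in> L" for b x
    unfolding G_def using L that by (intro Lag_perp) (auto simp: Lag_iff inner_commute)
  then show ?thesis using L by (auto simp: invariant_def Lag_iff)
qed

text \<open>The whole space is the orthogonal sum of \<open>L1\<close> and its image under
  \<open>J e\<close>. The extension is orthogonal and commutes with every \<open>J z\<close>, hence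
  preserves the bracket.\<close>

lemma isometric_iso_extends_to_Aut:
  assumes L1: "L1 \<in> Lag J" and L2: "L2 \<in> Lag J" and f: "isometric_iso f L1 L2"
  shows "\<exists>\<xi>\<in>Aut_o J. \<xi> ` L1 = L2"
proof -
  have sL: "subspace L1" and iso: "\<And>u w z. u \<in> L1 \<Longrightarrow> w \<in> L1 \<Longrightarrow> J z u \<bullet> w = 0"
    and iso2: "\<And>u w z. u \<in> L2 \<Longrightarrow> w \<in> L2 \<Longrightarrow> J z u \<bullet> w = 0"
    using L1 L2 by (auto simp: Lag_iff)
  note inv = invariant_JeJ[OF Lag_invariant[OF L1]]
  have lf: "linear f" and nf: "\<And>x. x \<in> L1 \<Longrightarrow> norm (f x) = norm x" and im: "f ` L1 = L2"
    and fG: "\<And>b x. b \<in> set l \<Longrightarrow> x \<in> L1 \<Longrightarrow> f (G b x) = G b (f x)"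
    using f by (auto simp: isometric_iso_def)
  have fJ: "f (J e (J z x)) = J e (J z (f x))" "f (J z (J e x)) = J z (J e (f x))" if "x \<in> L1" for x z
    using intertwiner_JeJ[OF lf] fG that by auto
  obtain P where P: "linear P" "\<And>x. P x \<in> L1" "\<And>x y. y \<in> L1 \<Longrightarrow> (x - P x) \<bullet> y = 0"
    "\<And>x. x \<in> L1 \<Longrightarrow> P x = x" "\<And>x. (\<And>y. y \<in> L1 \<Longrightarrow> x \<bullet> y = 0) \<Longrightarrow> P x = 0"
    using orthogonal_projection_exists[OF sL] by blast
  \<comment> \<open>The complementary part \<open>x - P x\<close> is \<open>J e v\<close> with
    \<open>v = - J e (x - P x)\<close>, which accounts for the minus sign in
    \<open>J e (f v)\<close>.\<close>
  define \<xi> where "\<xi> x = f (P x) - J e (f (J e (x - P x)))" for x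
  have "linear (J e \<circ> (f \<circ> (J e \<circ> (\<lambda>x. x - P x))))"
    by (intro linear_compose[OF _ J_linear] linear_compose[OF _ lf] linear_compose_sub[OF linear_ident P(1)])
  from linear_compose_sub[OF linear_compose[OF P(1) lf] this]
  have lxi: "linear \<xi>" by (simp add: \<xi>_def[abs_def] o_def)
  have xi: "\<xi> (u + J e v) = f u + J e (f v)" if "u \<in> L1" "v \<in> L1" for u v
  proof -
    have "P (J e v) = 0" using that iso by (intro P(5)) auto
    then have "P (u + J e v) = u" using that P(1,4) by (simp add: linear_add)
    then show ?thesis by (simp add: \<xi>_def linear_neg[OF lf] J_simps)
  qed
  have decomp: "\<exists>u\<in>L1. \<exists>v\<in>L1. x = u + J e v" for x
  proof -
    have "J e (x - P x) \<in> L1" using P(3) by (intro Lag_perp[OF L1]) (simp add: inner_commute)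
    then have "- J e (x - P x) \<in> L1" using sL by (simp add: subspace_neg)
    moreover have "x = P x + J e (- J e (x - P x))" by (simp add: J_simps)
    ultimately show ?thesis using P(2) by blast
  qed
  have nxi: "norm (\<xi> x) = norm x" for x
  proof -
    obtain u v where uv: "u \<in> L1" "v \<in> L1" "x = u + J e v" using decomp by blast
    have "orthogonal (f u) (J e (f v))" "orthogonal u (J e v)"
      using iso[OF uv(2,1), of e] iso2[of "f v" "f u" e] uv im by (auto simp: orthogonal_def inner_commute)
    then have "(norm (\<xi> x))\<^sup>2 = (norm x)\<^sup>2"
      using uv nf by (simp add: xi norm_add_Pythagorean norm_eq_sqrt_inner[of "J e _"] Je_isometry
          norm_eq_sqrt_inner[symmetric])
    then show ?thesis by (simp add: power2_eq_iff_nonneg)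
  qed
  have xiJ: "\<xi> (J z x) = J z (\<xi> x)" for z x
  proof -
    obtain u v where uv: "u \<in> L1" "v \<in> L1" "x = u + J e v" using decomp by blast
    \<comment> \<open>Again of the form \<open>u' + J e v'\<close>, with both components in
      \<open>L1\<close> because the even algebra preserves \<open>L1\<close>.\<close>
    have "J z x = J z (J e v) + J e (- J e (J z u))" using uv by (simp add: J_simps)
    then have "\<xi> (J z x) = f (J z (J e v)) + J e (f (- J e (J z u)))"
      using uv inv sL by (simp only:) (intro xi subspace_neg; simp)
    also have "\<dots> = J z (J e (f v)) + J z (f u)"
      using uv by (simp add: linear_neg[OF lf] fJ J_simps)
    finally show ?thesis using uv by (simp add: xi J_simps)
  qed
  have orth: "orthogonal_transformation \<xi>" using lxi nxi by (simp add: orthogonal_transformation)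
  have "hbracket J (\<xi> u) (\<xi> w) = hbracket J u w" for u w
  proof -
    have "z \<bullet> hbracket J (\<xi> u) (\<xi> w) = z \<bullet> hbracket J u w" for z
      using orth by (simp add: hbracket_inner xiJ[symmetric] orthogonal_transformation_def)
    then show ?thesis using vector_eq_ldot by blast
  qed
  then have "\<xi> \<in> Aut_o J"
    using lxi orthogonal_transformation_bij[OF orth] by (simp add: Aut_o_def)
  moreover have "\<xi> x = f x" if "x \<in> L1" for x
    using xi[OF that subspace_0[OF sL]] linear_0[OF lf] by (simp add: J_simps)
  then have "\<xi> ` L1 = L2" using im by auto
  ultimately show ?thesis by blast
qed

section \<open>Transitivity off multiples of 4, and the action of automorphisms\<close>

lemma length_l: "Suc (length l) = DIM('z)"
  using distinct_card[OF l(1)] card_Suc_Diff1[OF finite_Basis e] by (simp add: l(2))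

text \<open>There is one generator fewer than the dimension of the centre, so the exceptional length
  3 mod 4 corresponds to dimension 0 mod 4. Otherwise any two Lagrangians are compatible and of
  equal dimension.\<close>

lemma Aut_o_transitive:
  assumes "DIM('z) mod 4 \<noteq> 0" "L1 \<in> Lag J" "L2 \<in> Lag J"
  shows "\<exists>\<xi>\<in>Aut_o J. \<xi> ` L1 = L2"
proof -
  have "length l mod 4 \<noteq> 3" using assms(1) unfolding length_l[symmetric] by presburger
  then have "compatible L1 L2" by (simp add: compatible_def)
  moreover have "dim L1 = dim L2" using assms by (auto simp: Lag_iff)
  ultimately obtain f where "isometric_iso f L1 L2"
    using isometric_iso_exists Lag_invariant assms by blast
  then show ?thesis using isometric_iso_extends_to_Aut assms by blast
qed

text \<open>Although \<open>\<xi>\<close> may fail to be orthogonal, preserving the bracket means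
  \<open>T J z \<xi> = J z\<close> for its adjoint \<open>T\<close>. Inverting the case
  \<open>z = e\<close> gives \<open>\<xi> J e T = J e\<close>; substituting the general case yields
  the claim.\<close>

lemma Aut_o_commutes_JeJ:
  assumes "\<xi> \<in> Aut_o J"
  shows "\<xi> (J e (J z x)) = J e (J z (\<xi> x))"
proof -
  have xi: "linear \<xi>" "bij \<xi>" and br: "\<And>u w. hbracket J (\<xi> u) (\<xi> w) = hbracket J u w"
    using assms by (auto simp: Aut_o_def)
  define T where "T = adjoint \<xi>"
  have TJ: "T (J z (\<xi> u)) = J z u" for z u
  proof -
    have "T (J z (\<xi> u)) \<bullet> w = J z u \<bullet> w" for w
      using hbracket_inner[of z "\<xi> u" "\<xi> w"] hbracket_inner[of z u w]
      by (simp add: T_def adjoint_clauses(2)[OF xi(1)] br)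
    then show ?thesis using vector_eq_rdot by blast
  qed
  have "\<xi> (J e (T y)) = J e y" for y
  proof -
    obtain v where v: "\<xi> v = - J e y" using xi(2) by (metis bij_pointE)
    then have y: "y = J e (\<xi> v)" by (simp add: J_simps)
    have "\<xi> (J e (T y)) = \<xi> (- v)" by (simp add: y TJ)
    then show ?thesis using v by (simp add: linear_neg[OF xi(1)])
  qed
  from this[of "J z (\<xi> x)"] show ?thesis by (simp add: TJ)
qed

lemma Aut_o_commutes_word:
  assumes "\<xi> \<in> Aut_o J" "set w \<subseteq> set l"
  shows "\<xi> (foldr G w x) = foldr G w (\<xi> x)"
  using assms(2) by (induction w) (auto simp: G_def Aut_o_commutes_JeJ[OF assms(1)])

lemma Aut_o_dim_image:
  assumes "\<xi> \<in> Aut_o J"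
  shows "dim (\<xi> ` X) = dim X"
  using assms by (intro dim_image_eq) (auto simp: Aut_o_def bij_def intro: inj_on_subset)

lemma Aut_o_Lag:
  assumes "\<xi> \<in> Aut_o J" "L \<in> Lag J"
  shows "\<xi> ` L \<in> Lag J"
  using assms Aut_o_dim_image[OF assms(1), of L] linear_subspace_image[of \<xi> L]
  by (auto simp: Lag_def Aut_o_def)

text \<open>If the dimension of the centre is even, this is up to sign the product of
  \<open>J b\<close> over all basis vectors, since \<open>J e\<close> enters an odd number of
  times.\<close>

definition vol :: "'v \<Rightarrow> 'v" where "vol = foldr G l"

definition eig :: "real \<Rightarrow> 'v set \<Rightarrow> 'v set" where "eig s X = {x \<in> X. vol x = s *\<^sub>R x}"

lemma eig_subset: "eig s X \<subseteq> X"
  by (auto simp: eig_def)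

lemma eig_compatible: "X' \<subseteq> eig s X \<Longrightarrow> Y' \<subseteq> eig s Y \<Longrightarrow> compatible X' Y'"
  by (auto simp: compatible_def eig_def vol_def)

lemma vol_linear: "linear vol"
  unfolding vol_def by (rule word_linear) simp

lemmas vol_simps = linear_add[OF vol_linear] linear_diff[OF vol_linear] linear_neg[OF vol_linear]
  linear_cmul[OF vol_linear] linear_0[OF vol_linear]

lemma vol_invariant: "invariant X \<Longrightarrow> x \<in> X \<Longrightarrow> vol x \<in> X"
  unfolding vol_def by (rule word_invariant) simp

text \<open>Automorphisms commute with words in the generators, hence with \<open>vol\<close>. This
  makes the dimension of an eigenspace in a Lagrangian an orbit invariant.\<close>

lemma Aut_o_eig:
  assumes "\<xi> \<in> Aut_o J"
  shows "eig s (\<xi> ` X) = \<xi> ` eig s X"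
proof -
  have xi: "linear \<xi>" "inj \<xi>" using assms by (auto simp: Aut_o_def bij_def)
  have "vol (\<xi> x) = s *\<^sub>R \<xi> x \<longleftrightarrow> vol x = s *\<^sub>R x" for x
    using Aut_o_commutes_word[OF assms, of l x] linear_cmul[OF xi(1)] inj_eq[OF xi(2)]
    unfolding vol_def by (metis order_refl)
  then show ?thesis by (auto simp: eig_def)
qed

section \<open>The volume element when the dimension of the centre is divisible by 4\<close>

context
  assumes rank: "DIM('z) mod 4 = 0"
begin

lemma length_mod_4: "length l mod 4 = 3"
  using rank unfolding length_l[symmetric] by presburger

lemma odd_length: "odd (length l)"
  using length_mod_4 by presburger

lemma vol_square: "vol (vol x) = x"
  unfolding vol_def using word_square[of l x] l(1) length_mod_4 by simp

lemma vol_sym: "vol x \<bullet> y = x \<bullet> vol y"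
  unfolding vol_def using word_adjoint[of l x y] l(1) length_mod_4 by simp

lemma vol_G: "b \<in> set l \<Longrightarrow> vol (G b x) = G b (vol x)"
  unfolding vol_def using word_commute_in[of l b x] l(1) odd_length by simp

text \<open>\<open>J e\<close> anticommutes with each of an odd number of letters.\<close>

lemma vol_Je: "vol (J e x) = - J e (vol x)"
proof -
  have "J e (foldr G w x) = (-1) ^ length w *\<^sub>R foldr G w (J e x)" if "set w \<subseteq> set l" for w
    using that
  proof (induction w)
    case (Cons b w)
    then have "J e (foldr G (b # w) x) = - G b (J e (foldr G w x))" by (simp add: Je_G)
    also have "\<dots> = - G b ((-1) ^ length w *\<^sub>R foldr G w (J e x))" using Cons by simp
    finally show ?case using Cons.prems by (simp add: linear_cmul[OF lin])
  qed simp
  from this[of l] show ?thesis unfolding vol_def using odd_length by simp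
qed

lemma vol_JeJ: "vol (J e (J z x)) = J e (J z (vol x))"
  using intertwiner_JeJ(1)[OF vol_linear] vol_G by blast

text \<open>\<open>vol\<close> commutes with \<open>J e J z\<close> and anticommutes with the
  invertible \<open>J e\<close>, so it anticommutes with \<open>J z\<close>.\<close>

lemma vol_J: "vol (J z x) = - J z (vol x)"
proof -
  have "J e (vol (J z x)) = J e (- J z (vol x))"
    using vol_Je[of "J z x"] vol_JeJ[of z x] by (simp add: J_simps)
  then have "J e (J e (vol (J z x))) = J e (J e (- J z (vol x)))" by simp
  then show ?thesis by (simp add: minus_equation_iff)
qed

lemma eig_invariant:
  assumes "invariant X"
  shows "invariant (eig s X)"
proof -
  have "subspace (eig s X)"
    using invariant_subspace[OF assms] unfolding eig_def subspace_def
    by (auto simp: vol_simps algebra_simps)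
  moreover have "G b x \<in> eig s X" if "b \<in> set l" "x \<in> eig s X" for b x
    using that invariantD[OF assms] by (auto simp: eig_def vol_G linear_cmul[OF lin])
  ultimately show ?thesis by (simp add: invariant_def)
qed

text \<open>The eigenspaces of a symmetric involution are orthogonal complements of each other;
  \<open>x + vol x\<close> is twice the projection of \<open>x\<close> to the
  \<open>+1\<close>-eigenspace.\<close>

lemma ocomp_eig:
  assumes "invariant X"
  shows "ocomp X (eig 1 X) = eig (-1) X"
proof -
  note sX = invariant_subspace[OF assms]
  have "vol x = - x" if x: "x \<in> X" and o: "\<And>y. y \<in> eig 1 X \<Longrightarrow> y \<bullet> x = 0" for x
  proof -
    have "x + vol x \<in> eig 1 X"
      using x sX vol_invariant[OF assms x] by (simp add: eig_def subspace_add vol_simps vol_square)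
    then have "(x + vol x) \<bullet> x = 0" by (rule o)
    moreover have "(x + vol x) \<bullet> (x + vol x) = 2 * ((x + vol x) \<bullet> x)"
      by (simp add: inner_add_left inner_add_right vol_sym vol_square)
    ultimately have "x + vol x = 0" by simp
    then show ?thesis by (simp add: eq_neg_iff_add_eq_0 add.commute)
  qed
  moreover have "y \<bullet> x = 0" if "vol y = y" "vol x = - x" for x y
    using vol_sym[of y x] that by simp
  ultimately show ?thesis by (auto simp: ocomp_def eig_def orthogonal_def)
qed

lemma dim_eig:
  assumes "invariant X"
  shows "dim (eig (-1) X) + dim (eig 1 X) = dim X"
  using ocomp_dim[OF invariant_subspace[OF assms] invariant_subspace[OF eig_invariant[OF assms, of 1]]]
  by (simp add: ocomp_eig[OF assms] eig_subset)

lemma submodule_invariant: "submodule J X \<Longrightarrow> invariant X"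
  by (auto simp: submodule_def invariant_def G_def)

text \<open>\<open>J e\<close> preserves \<open>X\<close> and exchanges the two eigenspaces
  isometrically.\<close>

lemma dim_submodule:
  assumes "submodule J X"
  shows "dim X = 2 * dim (eig 1 X)"
proof -
  have X: "\<And>x. x \<in> X \<Longrightarrow> J e x \<in> X" "subspace X" using assms by (auto simp: submodule_def)
  note inv = submodule_invariant[OF assms]
  have "x \<in> J e ` eig 1 X" if "x \<in> eig (-1) X" for x
    using that X by (intro image_eqI[of _ _ "- J e x"])
      (auto simp: eig_def vol_simps vol_Je J_simps subspace_neg)
  then have "J e ` eig 1 X = eig (-1) X"
    using X by (auto simp: eig_def vol_Je)
  then have "dim (eig (-1) X) = dim (eig 1 X)"
    using dim_Je_image[OF invariant_subspace[OF eig_invariant[OF inv, of 1]]] by simp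
  then show ?thesis using dim_eig[OF inv] by simp
qed

text \<open>On each eigenspace \<open>vol\<close> is a scalar, so compatibility holds there and
  equal dimensions give an isomorphism. The two isomorphisms combine orthogonally and extend to an
  automorphism.\<close>

lemma same_orbit_if_dim_eig_eq:
  assumes L: "L1 \<in> Lag J" "L2 \<in> Lag J" and d: "dim (eig 1 L1) = dim (eig 1 L2)"
  shows "\<exists>\<xi>\<in>Aut_o J. \<xi> ` L1 = L2"
proof -
  have inv: "invariant L1" "invariant L2" using L Lag_invariant by auto
  have "dim L1 = dim L2" using L by (auto simp: Lag_iff)
  then have d': "dim (eig (-1) L1) = dim (eig (-1) L2)"
    using dim_eig[OF inv(1)] dim_eig[OF inv(2)] d by simp
  obtain f1 where f1: "isometric_iso f1 (eig 1 L1) (eig 1 L2)"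
    using isometric_iso_exists[OF eig_invariant eig_invariant d eig_compatible] inv by blast
  obtain f2 where f2: "isometric_iso f2 (eig (-1) L1) (eig (-1) L2)"
    using isometric_iso_exists[OF eig_invariant eig_invariant d' eig_compatible] inv by blast
  obtain f where "isometric_iso f L1 L2"
    using isometric_iso_combine[OF inv eig_invariant[OF inv(1)] _ _ f1, of f2] f2
    by (auto simp: ocomp_eig inv eig_subset)
  then show ?thesis using isometric_iso_extends_to_Aut L by blast
qed

lemma aut_orbit_eq:
  assumes "L \<in> Lag J"
  shows "aut_orbit J L = {L' \<in> Lag J. dim (eig 1 L') = dim (eig 1 L)}"
proof -
  have "\<xi> ` L \<in> Lag J \<and> dim (eig 1 (\<xi> ` L)) = dim (eig 1 L)" if "\<xi> \<in> Aut_o J" for \<xi>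
    using that assms by (simp add: Aut_o_Lag Aut_o_eig Aut_o_dim_image)
  moreover have "L' \<in> aut_orbit J L" if "L' \<in> Lag J" "dim (eig 1 L') = dim (eig 1 L)" for L'
    using same_orbit_if_dim_eig_eq[OF assms that(1)] that(2) by (auto simp: aut_orbit_def)
  ultimately show ?thesis by (auto simp: aut_orbit_def)
qed

section \<open>Lagrangians and submodules with prescribed eigenspaces\<close>

text \<open>The span of \<open>X\<close> and \<open>J\<^sub>e Y\<close>, for \<open>X\<close> and \<open>Y\<close> in the \<open>+1\<close>-eigenspace of \<^const>\<open>vol\<close>.\<close>

definition glue :: "'v set \<Rightarrow> 'v set \<Rightarrow> 'v set" where
  "glue X Y = {u. u + vol u \<in> X \<and> J e (u - vol u) \<in> Y}"

lemma glue_subspace: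
  assumes "subspace X" "subspace Y"
  shows "subspace (glue X Y)"
proof (rule subspaceI)
  show "0 \<in> glue X Y" using assms by (simp add: glue_def vol_simps J_simps subspace_0)
next
  fix u w assume "u \<in> glue X Y" "w \<in> glue X Y"
  moreover have "(u + w) + vol (u + w) = (u + vol u) + (w + vol w)"
    "J e ((u + w) - vol (u + w)) = J e (u - vol u) + J e (w - vol w)"
    by (simp_all add: vol_simps J_simps)
  ultimately show "u + w \<in> glue X Y" using assms unfolding glue_def mem_Collect_eq
    by (simp only: subspace_add)
next
  fix c u assume "u \<in> glue X Y"
  moreover have "c *\<^sub>R u + vol (c *\<^sub>R u) = c *\<^sub>R (u + vol u)"
    "J e (c *\<^sub>R u - vol (c *\<^sub>R u)) = c *\<^sub>R J e (u - vol u)"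
    by (simp_all add: vol_simps J_simps algebra_simps)
  ultimately show "c *\<^sub>R u \<in> glue X Y" using assms unfolding glue_def mem_Collect_eq
    by (simp only: subspace_scale)
qed

lemma glue_invariant:
  assumes "invariant X" "invariant Y"
  shows "invariant (glue X Y)"
proof -
  have "G b u \<in> glue X Y" if b: "b \<in> set l" and u: "u \<in> glue X Y" for b u
  proof -
    have "G b u + vol (G b u) = G b (u + vol u)"
      using b by (simp add: vol_G linear_add[OF lin])
    moreover have "J e (G b u - vol (G b u)) = - G b (J e (u - vol u))"
      using b by (simp add: vol_G linear_diff[OF lin, symmetric] Je_G)
    ultimately show ?thesis
      using b u assms by (simp add: glue_def invariantD subspace_neg invariant_subspace)
  qed
  then show ?thesis
    using glue_subspace assms by (simp add: invariant_def)
qed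

text \<open>\<open>J z\<close> exchanges the two components. With the \<open>-1\<close> component
  transported by \<open>J e\<close>, it acts through \<open>J z J e\<close> and
  \<open>J e J z\<close>, up to sign, and both preserve \<open>N\<close>.\<close>

lemma glue_submodule:
  assumes "invariant N"
  shows "submodule J (glue N N)"
proof -
  note sN = invariant_subspace[OF assms]
  have "J z u \<in> glue N N" if u: "u \<in> glue N N" for z u
  proof -
    have "J z u + vol (J z u) = - J z (J e (J e (u - vol u)))"
      by (simp add: vol_J J_simps)
    moreover have "J e (J z u - vol (J z u)) = J e (J z (u + vol u))"
      by (simp add: vol_J J_simps)
    ultimately show ?thesis
      using u sN invariant_JeJ[OF assms] by (simp add: glue_def subspace_neg del: e_simps(2))
  qed
  then show ?thesis using glue_subspace[OF sN sN] by (simp add: submodule_def)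
qed

text \<open>\<open>u + vol u\<close> and \<open>u - vol u\<close> are twice the components of
  \<open>u\<close> in the two eigenspaces; hence the halving.\<close>

lemma eig_glue:
  assumes "subspace X" "subspace Y" "X \<subseteq> eig 1 UNIV"
  shows "eig 1 (glue X Y) = X"
proof -
  have half: "u \<in> X" if "u + u \<in> X" for u
    using subspace_scale[OF assms(1) that, of "1/2"] by (simp flip: scaleR_2)
  have "u \<in> X" if "u \<in> eig 1 (glue X Y)" for u
    by (rule half) (use that in \<open>auto simp: eig_def glue_def\<close>)
  moreover have "u \<in> eig 1 (glue X Y)" if "u \<in> X" for u
  proof -
    have "vol u = u" using that assms(3) by (auto simp: eig_def)
    then show ?thesis using that assms(1,2)
      by (simp add: eig_def glue_def J_simps subspace_0 subspace_add)
  qed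
  ultimately show ?thesis by blast
qed

lemma eig_glue_neg:
  assumes "subspace X" "subspace Y" "Y \<subseteq> eig 1 UNIV"
  shows "eig (-1) (glue X Y) = J e ` Y"
proof -
  have "u \<in> J e ` Y" if "J e (u + u) \<in> Y" for u
  proof -
    have "J e (u + u) = 2 *\<^sub>R J e u" by (simp add: J_simps scaleR_2)
    then have "J e u \<in> Y" using subspace_scale[OF assms(2) that, of "1/2"] by simp
    then have "- J e u \<in> Y" using assms(2) by (simp add: subspace_neg)
    then show ?thesis by (rule image_eqI[rotated]) (simp add: J_simps)
  qed
  moreover have "J e y \<in> eig (-1) (glue X Y)" if "y \<in> Y" for y
  proof -
    have "vol y = y" using that assms(3) by (auto simp: eig_def)
    then show ?thesis using that assms
      by (simp add: eig_def glue_def vol_Je J_simps subspace_0 subspace_diff subspace_neg)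
  qed
  ultimately show ?thesis by (auto simp: eig_def glue_def)
qed

lemma glue_Lag:
  assumes X: "invariant X" "X \<subseteq> eig 1 UNIV" and Y: "Y = ocomp (eig 1 UNIV) X"
  shows "glue X Y \<in> Lag J"
proof -
  have iU: "invariant UNIV" by (simp add: invariant_def)
  note iE = eig_invariant[OF iU, of 1]
  have iY: "invariant Y" unfolding Y by (rule ocomp_invariant[OF iE X(1)])
  note s = invariant_subspace[OF X(1)] invariant_subspace[OF iY]
  have YE: "Y \<subseteq> eig 1 UNIV" by (auto simp: Y ocomp_def)
  have "dim (glue X Y) = dim Y + dim X"
    using dim_eig[OF glue_invariant[OF X(1) iY]] eig_glue[OF s X(2)] eig_glue_neg[OF s YE]
      dim_Je_image[OF s(2)] by simp
  also have "\<dots> = dim (eig 1 UNIV)"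
    unfolding Y by (rule ocomp_dim[OF invariant_subspace[OF iE] s(1) X(2)])
  finally have "2 * dim (glue X Y) = DIM('v)"
    using dim_submodule[of UNIV] by (simp add: submodule_def)
  moreover have "J z u \<bullet> w = 0" if u: "u \<in> glue X Y" and w: "w \<in> glue X Y" for z u w
  proof -
    \<comment> \<open>Applying the isometry \<open>J e\<close> to both sides moves the pairing into
      the \<open>+1\<close>-eigenspace, where \<open>X\<close> and \<open>Y\<close> are
      orthogonal.\<close>
    have cross: "J z (u + vol u) \<bullet> (w - vol w) = 0" if u: "u \<in> glue X Y" and w: "w \<in> glue X Y" for u w
    proof -
      have "J e (J z (u + vol u)) \<in> X" "J e (w - vol w) \<in> Y"
        using u w invariant_JeJ[OF X(1)] by (auto simp: glue_def)
      then have "J e (J z (u + vol u)) \<bullet> J e (w - vol w) = 0"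
        unfolding Y by (simp add: ocomp_def orthogonal_def)
      then show ?thesis by (simp add: Je_isometry)
    qed
    \<comment> \<open>Since \<open>vol\<close> changes the sign of this form, components with equal
      eigenvalue pair to zero and only the mixed pairings handled by \<open>cross\<close>
      remain.\<close>
    have "J z (vol u) \<bullet> vol w = - (J z u \<bullet> w)"
    proof -
      have "J z (vol u) \<bullet> vol w = vol (J z (vol u)) \<bullet> w" by (simp add: vol_sym)
      then show ?thesis by (simp add: vol_J vol_square)
    qed
    then have sum: "2 * (J z u \<bullet> w) = J z u \<bullet> w - J z (vol u) \<bullet> vol w" by simp
    have "J z (w + vol w) \<bullet> (u - vol u) = - ((w + vol w) \<bullet> J z (u - vol u))" by (rule J_skew)
    then have "J z (u - vol u) \<bullet> (w + vol w) = 0" using cross[OF w u] by (simp add: inner_commute)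
    with cross[OF u w] have "J z (u + vol u) \<bullet> (w - vol w) + J z (u - vol u) \<bullet> (w + vol w) = 0" by simp
    then show ?thesis using sum by (simp add: J_simps inner_simps)
  qed
  ultimately show ?thesis using glue_subspace[OF s] by (simp add: Lag_iff)
qed

section \<open>Irreducible submodules and counting orbits\<close>

lemma simple_eig_irreducible:
  assumes "irreducible_submodule J U"
  shows "simple (eig 1 U)"
proof -
  have U: "submodule J U" "U \<noteq> {0}" and irr: "\<And>M. submodule J M \<Longrightarrow> M \<subseteq> U \<Longrightarrow> M = {0} \<or> M = U"
    using assms by (auto simp: irreducible_submodule_def)
  note sU = invariant_subspace[OF submodule_invariant[OF U(1)]]
  have "dim U \<noteq> 0" using U(2) sU by (auto simp: subspace_0)
  then have "dim (eig 1 U) \<noteq> 0" using dim_submodule[OF U(1)] by presburger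
  then have ne: "eig 1 U \<noteq> {0}" by auto
  have "N = {0} \<or> N = eig 1 U" if N: "invariant N" "N \<subseteq> eig 1 U" for N
  proof -
    \<comment> \<open>A submodule of \<open>U\<close> whose \<open>+1\<close>-eigenspace is
      \<open>N\<close>; irreducibility of \<open>U\<close> thus forces \<open>N\<close> to be
      trivial or everything.\<close>
    define M where "M = U \<inter> glue N N"
    note sN = invariant_subspace[OF N(1)]
    have "submodule J M"
      using glue_submodule[OF N(1)] U(1) by (auto simp: M_def submodule_def subspace_inter)
    then have "M = {0} \<or> M = U" using irr by (auto simp: M_def)
    moreover have "eig 1 (glue N N) = N" using N by (intro eig_glue sN) (auto simp: eig_def)
    then have "eig 1 M = N" using N(2) by (auto simp: M_def eig_def)
    moreover have "eig 1 {0} = {0}" by (auto simp: eig_def vol_simps)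
    ultimately show ?thesis by auto
  qed
  then show ?thesis
    using ne eig_invariant[OF submodule_invariant[OF U(1)]] by (auto simp: simple_def)
qed

text \<open>Here \<open>d\<close> is half the dimension of an irreducible submodule. Divisibility
  and the bound \<open>dim L = p * d\<close> restrict the values; gluing a submodule of dimension
  \<open>k * d\<close> of the \<open>+1\<close>-eigenspace to its complement realises each
  one.\<close>

lemma dims_eig_Lag:
  assumes "isotypic_power J p"
  obtains d where "d > 0" "(\<lambda>L. dim (eig 1 L)) ` Lag J = (\<lambda>k. k * d) ` {0..p}"
proof -
  obtain U :: "nat \<Rightarrow> 'v set" where U: "\<And>i. i < p \<Longrightarrow> irreducible_submodule J (U i)"
    and dU: "(\<Sum>i<p. dim (U i)) = DIM('v)"
    using assms by (auto simp: isotypic_power_def)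
  have "p \<noteq> 0"
  proof
    assume "p = 0"
    then have "DIM('v) = 0" using dU by simp
    then show False by simp
  qed
  define S where "S = eig 1 (U 0)"
  define d where "d = dim S"
  have sim: "simple (eig 1 (U i))" if "i < p" for i using simple_eig_irreducible U that by blast
  then have S: "simple S" using \<open>p \<noteq> 0\<close> by (simp add: S_def)
  then have "S \<noteq> {0}" "subspace S" by (auto simp: simple_def invariant_subspace)
  then have d0: "d > 0" unfolding d_def by (auto simp: subspace_0)
  have dvd: "d dvd dim (eig 1 X)" if "invariant X" for X
    unfolding d_def by (rule simple_dim_dvd[OF S eig_invariant[OF that] eig_compatible[of S 1 "U 0"]])
      (auto simp: S_def)
  \<comment> \<open>The simple \<open>+1\<close> parts of \<open>U i\<close> and \<open>U 0\<close>
    embed in each other, so their dimensions divide each other.\<close>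
  have "dim (U i) = 2 * d" if "i < p" for i
  proof -
    have sub: "submodule J (U i)" using U that by (auto simp: irreducible_submodule_def)
    have "invariant S" using S by (simp add: simple_def)
    then have "dim (eig 1 (U i)) dvd d"
      unfolding d_def using simple_dim_dvd[OF sim[OF that] _ eig_compatible[of _ 1 "U i" S "U 0"]]
      by (auto simp: S_def)
    moreover have "d dvd dim (eig 1 (U i))" using dvd submodule_invariant sub by blast
    ultimately show ?thesis using dim_submodule[OF sub] by (simp add: dvd_antisym)
  qed
  then have DV: "DIM('v) = 2 * (p * d)" using dU by simp
  have iU: "invariant UNIV" by (simp add: invariant_def)
  have dE: "dim (eig 1 UNIV) = p * d"
    using dim_submodule[of UNIV] DV by (simp add: submodule_def)
  have "dim (eig 1 L) \<in> (\<lambda>k. k * d) ` {0..p}" if L: "L \<in> Lag J" for L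
  proof -
    obtain k where k: "dim (eig 1 L) = d * k" using dvd[OF Lag_invariant[OF L]] by blast
    have "dim (eig 1 L) \<le> dim L" by (rule dim_subset) (auto simp: eig_def)
    also have "dim L = p * d" using L DV by (simp add: Lag_iff)
    finally have "k \<le> p" using k d0 by (simp add: mult.commute)
    then show ?thesis using k by (auto simp: mult.commute)
  qed
  moreover have "k * d \<in> (\<lambda>L. dim (eig 1 L)) ` Lag J" if "k \<le> p" for k
  proof -
    \<comment> \<open>Removing \<open>p - k\<close> of the \<open>p\<close> copies of
      \<open>S\<close> in the \<open>+1\<close>-eigenspace leaves dimension
      \<open>k * d\<close>.\<close>
    have "(p - k) * d \<le> dim (eig 1 UNIV)" unfolding dE by simp
    then obtain X where X: "X \<subseteq> eig 1 UNIV" "invariant X" "dim X + (p - k) * d = p * d"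
      using invariant_subspace_of_codim[OF S eig_invariant[OF iU] eig_compatible[of S 1 "U 0"], of 1 UNIV "p - k"]
      unfolding dE d_def by (auto simp: S_def)
    have "p * d = k * d + (p - k) * d" using that by (simp flip: add_mult_distrib)
    then have "dim X = k * d" using X(3) by simp
    moreover define Y where "Y = ocomp (eig 1 UNIV) X"
    have "subspace Y" unfolding Y_def
      by (rule invariant_subspace[OF ocomp_invariant[OF eig_invariant[OF iU] X(2)]])
    then have "eig 1 (glue X Y) = X" using eig_glue invariant_subspace X by blast
    moreover have "glue X Y \<in> Lag J" using glue_Lag X Y_def by blast
    ultimately show ?thesis by (intro image_eqI[of _ _ "glue X Y"]) auto
  qed
  ultimately have "(\<lambda>L. dim (eig 1 L)) ` Lag J = (\<lambda>k. k * d) ` {0..p}" by auto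
  then show thesis using that d0 by blast
qed

text \<open>Orbits are exactly the nonempty fibres of the eigenspace dimension, and the
  \<open>p + 1\<close> multiples of \<open>d > 0\<close> are distinct.\<close>

lemma card_orbits:
  assumes "isotypic_power J p"
  shows "Lag J = \<Union> (aut_orbit J ` Lag J)" "card (aut_orbit J ` Lag J) = p + 1"
proof -
  show "Lag J = \<Union> (aut_orbit J ` Lag J)" by (auto simp: aut_orbit_eq)
  define \<delta> where "\<delta> L = dim (eig 1 L)" for L
  define F where "F n = {L \<in> Lag J. \<delta> L = n}" for n
  obtain d where d: "d > 0" "\<delta> ` Lag J = (\<lambda>k. k * d) ` {0..p}"
    using dims_eig_Lag[OF assms] unfolding \<delta>_def by blast
  have "aut_orbit J ` Lag J = F ` \<delta> ` Lag J"
    unfolding image_image F_def \<delta>_def by (intro image_cong refl) (rule aut_orbit_eq)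
  moreover have "inj_on F (\<delta> ` Lag J)" by (rule inj_onI) (auto simp: F_def)
  ultimately have "card (aut_orbit J ` Lag J) = card (\<delta> ` Lag J)" by (simp add: card_image)
  also have "\<dots> = p + 1"
    unfolding d(2) using d(1) by (subst card_image) (auto simp: inj_on_def)
  finally show "card (aut_orbit J ` Lag J) = p + 1" .
qed

end

end

theorem theorem4p6:
  fixes J :: "'z::euclidean_space \<Rightarrow> 'v::euclidean_space \<Rightarrow> 'v"
  assumes "htype J"
  shows "(DIM('z) mod 4 \<noteq> 0 \<longrightarrow>
            (\<forall>L1\<in>Lag J. \<forall>L2\<in>Lag J. \<exists>\<xi>\<in>Aut_o J. \<xi> ` L1 = L2))
       \<and> (\<forall>p. DIM('z) mod 4 = 0 \<and> isotypic_power J p \<longrightarrow>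
            Lag J = \<Union> (aut_orbit J ` Lag J) \<and> card (aut_orbit J ` Lag J) = p + 1)"
proof -
  obtain e :: 'z where e: "e \<in> Basis" using nonempty_Basis by blast
  obtain l where l: "set l = Basis - {e}" "distinct l"
    using finite_distinct_list[of "Basis - {e}"] finite_Basis by blast
  interpret htype_module J e l
    by (rule htype_module.intro[OF assms e l(2) l(1)])
  show ?thesis
  proof (intro conjI allI impI ballI)
    fix p assume "DIM('z) mod 4 = 0 \<and> isotypic_power J p"
    then have m: "DIM('z) mod 4 = 0" and iso: "isotypic_power J p" by simp_all
    show "Lag J = \<Union> (aut_orbit J ` Lag J)" by (rule card_orbits(1)[OF m iso])
    show "card (aut_orbit J ` Lag J) = p + 1" by (rule card_orbits(2)[OF m iso])
  qed (rule Aut_o_transitive)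
qed

end
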